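(* There is an absolute constant $C_0\ge 3\times 10^3$ such that the following holds. Let $k\ge 2$ and $r\ge 0$ be integers, let $n\ge C_0(r+1)^3(k+r)k^2$, and let $\delta\in\left[\frac{150k^3(r+1)^2}{n},\,1-\frac{150k^3(r+1)^3}{n}\right]\cup\{1\}$. If $\mathcal F\subseteq\binom{[n]}{k}$ satisfies $$|\mathcal F|=\sum_{i=1}^{r}\binom{n-i}{k-1}+\delta\binom{n-(r+1)}{k-1}$$ and $\mathcal I(\mathcal F)=\mathcal{MI}(\mathcal F)$, then, up to isomorphism, $\mathcal L^{(r)}_{n,k,1}\subseteq\mathcal F\subseteq\mathcal L^{(r+1)}_{n,k,1}$.
   Context: $[n]=\{1,\dots,n\}$ and $\binom{[n]}{k}$ is the family of all $k$-element subsets of $[n]$. For $\mathcal F\subseteq\binom{[n]}{k}$ and $x\in[n]$, $\mathcal F(x)=\{F\in\mathcal F: x\in F\}$. The total intersection is $\mathcal I(\mathcal F)=\sum_{A\in\mathcal F}\sum_{B\in\mathcal F}|A\cap B|=\sum_{x\in[n]}|\mathcal F(x)|^2$ (sum over ordered pairs, including $A=B$), and $\mathcal{MI}(\mathcal F)=\max\{\mathcal I(\mathcal G):\mathcal G\subseteq\binom{[n]}{k},\ |\mathcal G|=|\mathcal F|\}$. Lexicographic order on $\binom{[n]}{k}$: $F_1$ precedes $F_2$ if the minimum element of the symmetric difference $F_1\triangle F_2$ lies in $F_1$. For $t\ge1$, $r\ge 0$, $\mathcal L^{(r)}_{n,k,t}$ denotes the family of the first $\binom{n-t+1}{k-t+1}-\binom{n-(t+r-1)}{k-t+1}$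 $k$-subsets of $[n]$ in lexicographic order. "Up to isomorphism" means after applying some permutation of $[n]$ to all sets of $\mathcal F$. The size condition implicitly requires $|\mathcal F|$ to be an integer. *)

theory Defs
  imports Complex_Main "HOL-Combinatorics.Permutations"
begin

definition ksubsets :: "nat \<Rightarrow> nat \<Rightarrow> nat set set" where
  "ksubsets n k = {F. F \<subseteq> {1..n} \<and> card F = k}"

definition star_fam :: "nat set set \<Rightarrow> nat \<Rightarrow> nat set set" where
  "star_fam \<F> x = {F \<in> \<F>. x \<in> F}"

definition total_inter :: "nat \<Rightarrow> nat set set \<Rightarrow> nat" where
  "total_inter n \<F> = (\<Sum>x\<in>{1..n}. (card (star_fam \<F> x))^2)"

definition max_total_inter :: "nat \<Rightarrow> nat \<Rightarrow> nat set set \<Rightarrow> nat" where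
  "max_total_inter n k \<F> =
     Max {total_inter n \<G> | \<G>. \<G> \<subseteq> ksubsets n k \<and> card \<G> = card \<F>}"

definition lex_less :: "nat set \<Rightarrow> nat set \<Rightarrow> bool" where
  "lex_less F1 F2 \<longleftrightarrow> F1 \<noteq> F2 \<and> Min ((F1 - F2) \<union> (F2 - F1)) \<in> F1"

definition lex_first :: "nat \<Rightarrow> nat \<Rightarrow> nat \<Rightarrow> nat set set" where
  "lex_first n k m = {A \<in> ksubsets n k. card {B \<in> ksubsets n k. lex_less B A} < m}"

definition lex_fam :: "nat \<Rightarrow> nat \<Rightarrow> nat \<Rightarrow> nat \<Rightarrow> nat set set" where
  "lex_fam n k t r = lex_first n k
     (((n - t + 1) choose (k - t + 1)) - ((n - (t + r - 1)) choose (k - t + 1)))"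

end

theory Submission
  imports Defs
begin

text \<open>
  Exchanging one set shows that an optimal \<open>\<F>\<close> is a strict threshold family for the weights
  \<open>w(A) = (\<Sum>x\<in>A. d x)\<close>, where \<open>d\<close> is its own degree function; relabel so that \<open>d\<close> is
  nonincreasing. Write \<open>N = (n - 1 choose k - 1)\<close>. Comparing \<open>\<F>\<close> with a lexicographic-type
  family gives \<open>(\<Sum>x. (d x)\<^sup>2) \<ge> N\<^sup>2 (r + \<delta>\<^sup>2)\<close>, while by Bonferroni the degrees over a small
  vertex set sum to little more than \<open>N (r + \<delta>)\<close>. Hence \<open>d 1, \<dots>, d r\<close> are close to \<open>N\<close>,
  \<open>d (r + 1)\<close> is close to \<open>\<delta> N\<close> and the rest is small. By the threshold property,
  \<open>\<F>\<close> contains every set meeting \<open>[r]\<close> if \<open>\<delta> \<le> 1/2\<close>, and every member of \<open>\<F>\<close> meets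
  \<open>[r + 1]\<close> if \<open>\<delta> \<ge> 1/2\<close>.

  The other inclusion has to be proved up to \<open>\<delta>\<close> or \<open>1 - \<delta>\<close> of order \<open>1/n\<close>, where this
  estimate is too coarse. But the family of all sets meeting \<open>[r]\<close> has constant degree outside
  \<open>[r]\<close>, so the surplus \<open>\<E> = \<F> - hits n k r\<close> satisfies
  \<open>(\<Sum>x. (deg \<E> x)\<^sup>2) \<ge> (card \<E>)\<^sup>2\<close>; the same holds for the missing part
  \<open>\<E> = hits n k (r + 1) - \<F>\<close>. Such an \<open>\<E>\<close> has a vertex contained in two thirds of its
  members, and one more application of the threshold property makes it a star avoiding \<open>[r]\<close>.
\<close>

definition deg :: "nat set set \<Rightarrow> nat \<Rightarrow> real" where
  "deg \<F> x = real (card (star_fam \<F> x))"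

text \<open>By \<open>lex_fam_eq_hits\<close> this is the lexicographic family with t = 1; the
  direct description lets degrees be counted without the order.\<close>

definition hits :: "nat \<Rightarrow> nat \<Rightarrow> nat \<Rightarrow> nat set set" where
  "hits n k r = {A \<in> ksubsets n k. A \<inter> {1..r} \<noteq> {}}"

text \<open>Members keep \<open>x\<close>, unlike in the usual link. For \<open>x = r + 1\<close>
  this is the layer between \<open>hits n k r\<close> and \<open>hits n k (r + 1)\<close>.\<close>

definition link :: "nat \<Rightarrow> nat \<Rightarrow> nat \<Rightarrow> nat \<Rightarrow> nat set set" where
  "link n k r x = {A \<in> ksubsets n k. x \<in> A \<and> A \<inter> {1..r} = {}}"

subsection \<open>Counting\<close>

lemma finite_ksubsets [simp]: "finite (ksubsets n k)"
  by (rule finite_subset[of _ "Pow {1..n}"]) (auto simp: ksubsets_def)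

lemma finite_ksubset_family: "\<F> \<subseteq> ksubsets n k \<Longrightarrow> finite \<F>"
  using finite_subset finite_ksubsets by blast

lemma card_supersets:
  assumes "finite U" "S \<subseteq> U" "card S \<le> k"
  shows "card {A. A \<subseteq> U \<and> S \<subseteq> A \<and> card A = k} = (card U - card S) choose (k - card S)"
proof -
  have fS: "finite S" using assms finite_subset by blast
  have "bij_betw (\<lambda>A. A - S) {A. A \<subseteq> U \<and> S \<subseteq> A \<and> card A = k}
      {B. B \<subseteq> U - S \<and> card B = k - card S}"
  proof (rule bij_betw_byWitness[where f' = "\<lambda>B. B \<union> S"])
    show "(\<lambda>A. A - S) ` {A. A \<subseteq> U \<and> S \<subseteq> A \<and> card A = k}
        \<subseteq> {B. B \<subseteq> U - S \<and> card B = k - card S}"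
      using fS by (auto simp: card_Diff_subset)
    show "(\<lambda>B. B \<union> S) ` {B. B \<subseteq> U - S \<and> card B = k - card S}
        \<subseteq> {A. A \<subseteq> U \<and> S \<subseteq> A \<and> card A = k}"
    proof
      fix A assume "A \<in> (\<lambda>B. B \<union> S) ` {B. B \<subseteq> U - S \<and> card B = k - card S}"
      then obtain B where B: "A = B \<union> S" "B \<subseteq> U - S" "card B = k - card S" by blast
      have "finite B" using B assms(1) finite_subset by blast
      hence "card A = card B + card S"
        using B(1,2) fS card_Un_disjoint[of B S] by blast
      thus "A \<in> {A. A \<subseteq> U \<and> S \<subseteq> A \<and> card A = k}"
        using B assms by auto
    qed
  qed auto
  hence "card {A. A \<subseteq> U \<and> S \<subseteq> A \<and> card A = k} = card {B. B \<subseteq> U - S \<and> card B = k - card S}"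
    by (rule bij_betw_same_card)
  also have "\<dots> = card (U - S) choose (k - card S)"
    using assms by (intro n_subsets) auto
  finally show ?thesis using assms fS by (simp add: card_Diff_subset)
qed

lemma avoid_iff:
  fixes A :: "nat set"
  shows "A \<subseteq> {1..n} \<and> A \<inter> {1..r} = {} \<longleftrightarrow> A \<subseteq> {r + 1..n}"
proof -
  have "{1..n} - {1..r} = {r + 1..n}" by auto
  thus ?thesis by blast
qed

lemma card_star_ksubsets:
  assumes "x \<in> {1..n}" "1 \<le> k"
  shows "card (star_fam (ksubsets n k) x) = (n - 1) choose (k - 1)"
proof -
  have "star_fam (ksubsets n k) x = {A. A \<subseteq> {1..n} \<and> {x} \<subseteq> A \<and> card A = k}"
    by (auto simp: star_fam_def ksubsets_def)
  thus ?thesis using card_supersets[of "{1..n}" "{x}" k] assms by simp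
qed

lemma card_link:
  assumes "x \<in> {r + 1..n}" "1 \<le> k"
  shows "card (link n k r x) = (n - (r + 1)) choose (k - 1)"
proof -
  have "link n k r x = {A. A \<subseteq> {r + 1..n} \<and> {x} \<subseteq> A \<and> card A = k}"
    unfolding link_def ksubsets_def avoid_iff[symmetric] by blast
  thus ?thesis using card_supersets[of "{r + 1..n}" "{x}" k] assms
    by (simp add: diff_diff_left)
qed

lemma codegree_le:
  assumes "\<F> \<subseteq> ksubsets n k" "x \<noteq> y" "2 \<le> k"
  shows "card (star_fam \<F> x \<inter> star_fam \<F> y) \<le> (n - 2) choose (k - 2)"
proof (cases "{x, y} \<subseteq> {1..n}")
  case True
  have fin: "finite {A. A \<subseteq> {1..n} \<and> {x, y} \<subseteq> A \<and> card A = k}"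
    by (rule finite_subset[of _ "Pow {1..n}"]) auto
  have "card (star_fam \<F> x \<inter> star_fam \<F> y) \<le> card {A. A \<subseteq> {1..n} \<and> {x, y} \<subseteq> A \<and> card A = k}"
    using assms(1) by (intro card_mono fin) (auto simp: star_fam_def ksubsets_def)
  also have "\<dots> = (n - 2) choose (k - 2)"
    using card_supersets[of "{1..n}" "{x, y}" k] True assms by (simp add: numeral_2_eq_2)
  finally show ?thesis .
next
  case False
  hence "star_fam \<F> x \<inter> star_fam \<F> y = {}"
    using assms(1) unfolding star_fam_def ksubsets_def by blast
  thus ?thesis by simp
qed

lemma hits_subset: "hits n k r \<subseteq> ksubsets n k"
  by (auto simp: hits_def)

lemma card_hits_add:
  assumes "r \<le> n"
  shows "card (hits n k r) + ((n - r) choose k) = n choose k"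
proof -
  have "ksubsets n k - hits n k r = {A. A \<subseteq> {r + 1..n} \<and> card A = k}"
    unfolding hits_def ksubsets_def avoid_iff[symmetric] by blast
  hence 1: "card (ksubsets n k - hits n k r) = (n - r) choose k"
    using n_subsets[of "{r + 1..n}" k] by simp
  have "card (ksubsets n k) = n choose k"
    using n_subsets[of "{1..n}" k] by (simp add: ksubsets_def)
  moreover have "card (hits n k r) + card (ksubsets n k - hits n k r) = card (ksubsets n k)"
    using card_Diff_subset[OF finite_ksubset_family[OF hits_subset] hits_subset, of n k r]
      card_mono[OF finite_ksubsets hits_subset, of n k r] by linarith
  ultimately show ?thesis using 1 by simp
qed

lemma card_hits_Suc:
  assumes "r < n" "1 \<le> k"
  shows "card (hits n k (Suc r)) = card (hits n k r) + ((n - (r + 1)) choose (k - 1))"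
proof -
  obtain j where j: "k = Suc j" using assms by (cases k) auto
  have "n - r = Suc (n - (r + 1))" using assms by simp
  hence "(n - r) choose k = ((n - (r + 1)) choose k) + ((n - (r + 1)) choose (k - 1))"
    by (simp add: j)
  thus ?thesis using card_hits_add[of r n k] card_hits_add[of "Suc r" n k] assms by simp
qed

lemma card_hits_sum:
  assumes "r \<le> n" "1 \<le> k"
  shows "card (hits n k r) = (\<Sum>i=1..r. (n - i) choose (k - 1))"
  using assms(1)
proof (induction r)
  case 0
  show ?case by (simp add: hits_def)
next
  case (Suc r)
  thus ?case using card_hits_Suc[of r n k] assms(2) by simp
qed

section \<open>Lexicographic initial segments\<close>

lemma lex_less_hits:
  assumes "A \<in> ksubsets n k" "B \<in> hits n k r" "A \<notin> hits n k r"
  shows "lex_less B A" "\<not> lex_less A B"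
proof -
  define D where "D = (B - A) \<union> (A - B)"
  have fin: "finite D"
    using assms finite_subset[of _ "{1..n}"] by (auto simp: D_def hits_def ksubsets_def)
  obtain x where x: "x \<in> B" "x \<in> {1..r}" using assms(2) unfolding hits_def by blast
  have Ar: "A \<inter> {1..r} = {}" using assms unfolding hits_def by blast
  hence xD: "x \<in> D" using x by (auto simp: D_def)
  \<comment> \<open>\<open>D\<close> contains a point of [r], so its minimum lies in [r]; since
    \<open>A\<close> avoids [r], the minimum belongs to \<open>B\<close>.\<close>
  have "Min D \<le> r" using Min_le[OF fin xD] x by simp
  moreover have mD: "Min D \<in> D" using fin xD Min_in by blast
  moreover have "D \<subseteq> {1..n}" using assms by (auto simp: D_def hits_def ksubsets_def)
  ultimately have "Min D \<in> {1..r}" by auto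
  hence "Min D \<notin> A" using Ar by blast
  moreover from this mD have "Min D \<in> B" by (auto simp: D_def)
  moreover have "B \<noteq> A" using x Ar by blast
  ultimately show "lex_less B A" "\<not> lex_less A B"
    by (auto simp: lex_less_def D_def Un_commute)
qed

text \<open>Sets meeting [r] precede all others, so a set has fewer than
  \<open>card (hits n k r)\<close> predecessors exactly when it meets [r].\<close>

lemma lex_fam_eq_hits:
  assumes "r \<le> n" "1 \<le> k" "1 \<le> n"
  shows "lex_fam n k 1 r = hits n k r"
proof -
  have fh: "finite (hits n k r)" using finite_ksubset_family hits_subset by blast
  have size: "(n - 1 + 1 choose (k - 1 + 1)) - (n - (1 + r - 1) choose (k - 1 + 1)) = card (hits n k r)"
    using card_hits_add[OF assms(1), of k] assms by simp
  have "card {B \<in> ksubsets n k. lex_less B A} < card (hits n k r) \<longleftrightarrow> A \<in> hits n k r"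
    if A: "A \<in> ksubsets n k" for A
  proof
    assume "A \<in> hits n k r"
    hence "{B \<in> ksubsets n k. lex_less B A} \<subset> hits n k r"
      using lex_less_hits(2)[of _ n k A r] by (auto simp: lex_less_def)
    thus "card {B \<in> ksubsets n k. lex_less B A} < card (hits n k r)"
      using fh psubset_card_mono by blast
  next
    assume less: "card {B \<in> ksubsets n k. lex_less B A} < card (hits n k r)"
    show "A \<in> hits n k r"
    proof (rule ccontr)
      assume "A \<notin> hits n k r"
      hence "hits n k r \<subseteq> {B \<in> ksubsets n k. lex_less B A}"
        using lex_less_hits(1)[OF A] hits_subset by blast
      hence "card (hits n k r) \<le> card {B \<in> ksubsets n k. lex_less B A}"
        by (intro card_mono) auto
      thus False using less by simp
    qed
  qed
  thus ?thesis unfolding lex_fam_def lex_first_def size using hits_subset by blast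
qed

subsection \<open>Degrees\<close>

lemma deg_nonneg [simp]: "0 \<le> deg \<F> x"
  by (simp add: deg_def)

lemma finite_star_fam: "finite \<F> \<Longrightarrow> finite (star_fam \<F> x)"
  by (simp add: star_fam_def)

lemma deg_Un_disjoint:
  assumes "finite \<F>" "finite \<G>" "\<F> \<inter> \<G> = {}"
  shows "deg (\<F> \<union> \<G>) x = deg \<F> x + deg \<G> x"
proof -
  have "star_fam (\<F> \<union> \<G>) x = star_fam \<F> x \<union> star_fam \<G> x"
    by (auto simp: star_fam_def)
  moreover have "star_fam \<F> x \<inter> star_fam \<G> x = {}"
    using assms(3) by (auto simp: star_fam_def)
  ultimately show ?thesis
    using assms by (simp add: deg_def card_Un_disjoint finite_star_fam)
qed

lemma deg_mono: "finite \<G> \<Longrightarrow> \<F> \<subseteq> \<G> \<Longrightarrow> deg \<F> x \<le> deg \<G> x"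
  unfolding deg_def star_fam_def by (auto intro!: card_mono)

lemma deg_singleton: "deg {A} x = (if x \<in> A then 1 else 0)"
proof -
  have "star_fam {A} x = (if x \<in> A then {A} else {})" by (auto simp: star_fam_def)
  thus ?thesis by (simp add: deg_def)
qed

lemma deg_alt: "finite \<F> \<Longrightarrow> deg \<F> x = (\<Sum>A\<in>\<F>. if x \<in> A then 1 else 0)"
  by (simp add: deg_def star_fam_def sum.If_cases Int_def)

lemma sum_deg:
  assumes "finite \<F>" "finite X"
  shows "(\<Sum>x\<in>X. deg \<F> x) = (\<Sum>A\<in>\<F>. real (card (A \<inter> X)))"
proof -
  have "(\<Sum>x\<in>X. deg \<F> x) = (\<Sum>A\<in>\<F>. \<Sum>x\<in>X. if x \<in> A then 1 else 0)"
    by (simp add: deg_alt assms(1)) (rule sum.swap)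
  also have "\<dots> = (\<Sum>A\<in>\<F>. real (card (A \<inter> X)))"
    by (rule sum.cong) (simp_all add: sum.If_cases assms(2) Int_commute)
  finally show ?thesis .
qed

lemma sum_deg_ksubsets:
  assumes "\<F> \<subseteq> ksubsets n k"
  shows "(\<Sum>x\<in>{1..n}. deg \<F> x) = real k * real (card \<F>)"
proof -
  have "(\<Sum>x\<in>{1..n}. deg \<F> x) = (\<Sum>A\<in>\<F>. real (card (A \<inter> {1..n})))"
    using assms finite_ksubset_family by (intro sum_deg) auto
  also have "\<dots> = (\<Sum>A\<in>\<F>. real k)"
    using assms by (intro sum.cong) (auto simp: ksubsets_def Int_absorb2)
  finally show ?thesis by simp
qed

lemma total_inter_eq: "real (total_inter n \<F>) = (\<Sum>x\<in>{1..n}. (deg \<F> x)\<^sup>2)"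
  by (simp add: total_inter_def deg_def)

section \<open>Bonferroni bounds for degree sums\<close>

text \<open>A new vertex overlaps the old union in at most \<open>card T\<close> codegrees. Doubling
  avoids (t choose 2), and t^2 + 2 t \<le> (t + 1)^2 closes the induction.\<close>

lemma sum_deg_le_Union:
  assumes "\<F> \<subseteq> ksubsets n k" "2 \<le> k" "finite T"
  shows "2 * (\<Sum>x\<in>T. deg \<F> x) \<le> 2 * real (card (\<Union>x\<in>T. star_fam \<F> x))
           + (real (card T))\<^sup>2 * real ((n - 2) choose (k - 2))"
  using assms(3)
proof (induction T rule: finite_induct)
  case empty
  show ?case by simp
next
  case (insert v T)
  define c where "c = real ((n - 2) choose (k - 2))"
  have fF: "finite \<F>" using assms(1) finite_ksubset_family by blast
  define U where "U = (\<Union>x\<in>T. star_fam \<F> x)"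
  have fU: "finite U" using insert.hyps fF by (auto simp: U_def finite_star_fam)
  have "card (star_fam \<F> v \<inter> U) \<le> (\<Sum>x\<in>T. card (star_fam \<F> v \<inter> star_fam \<F> x))"
    unfolding U_def Int_UN_distrib using insert.hyps by (intro card_UN_le)
  also have "\<dots> \<le> (\<Sum>x\<in>T. (n - 2) choose (k - 2))"
    using insert.hyps assms by (intro sum_mono codegree_le) auto
  finally have "card (star_fam \<F> v \<inter> U) \<le> card T * ((n - 2) choose (k - 2))" by simp
  hence 1: "real (card (star_fam \<F> v \<inter> U)) \<le> real (card T) * c"
    unfolding c_def by (metis of_nat_le_iff of_nat_mult)
  have "card (star_fam \<F> v) + card U = card (star_fam \<F> v \<union> U) + card (star_fam \<F> v \<inter> U)"
    using fU fF by (intro card_Un_Int) (auto simp: finite_star_fam)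
  hence 2: "deg \<F> v + real (card U)
      = real (card (star_fam \<F> v \<union> U)) + real (card (star_fam \<F> v \<inter> U))"
    unfolding deg_def by (metis of_nat_add)
  have c0: "0 \<le> c" by (simp add: c_def)
  have "2 * (\<Sum>x\<in>insert v T. deg \<F> x) = 2 * deg \<F> v + 2 * (\<Sum>x\<in>T. deg \<F> x)"
    using insert.hyps by simp
  also have "\<dots> \<le> 2 * deg \<F> v + (2 * real (card U) + (real (card T))\<^sup>2 * c)"
    using insert.IH by (simp add: c_def U_def)
  also have "\<dots> \<le> 2 * real (card (star_fam \<F> v \<union> U)) + 2 * (real (card T) * c) + (real (card T))\<^sup>2 * c"
    using 1 2 by linarith
  also have "\<dots> \<le> 2 * real (card (star_fam \<F> v \<union> U)) + (real (card (insert v T)))\<^sup>2 * c"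
    using insert.hyps c0 by (simp add: power2_eq_square algebra_simps)
  finally show ?case by (simp add: c_def U_def)
qed

lemma sum_deg_le:
  assumes "\<F> \<subseteq> ksubsets n k" "2 \<le> k" "finite T" "real (card T) \<le> t"
  shows "2 * (\<Sum>x\<in>T. deg \<F> x) \<le> 2 * real (card \<F>) + t\<^sup>2 * real ((n - 2) choose (k - 2))"
proof -
  have fF: "finite \<F>" using assms(1) finite_ksubset_family by blast
  have "card (\<Union>x\<in>T. star_fam \<F> x) \<le> card \<F>"
    using fF by (intro card_mono) (auto simp: star_fam_def)
  moreover have "(real (card T))\<^sup>2 * real ((n - 2) choose (k - 2)) \<le> t\<^sup>2 * real ((n - 2) choose (k - 2))"
    using assms(4) by (intro mult_right_mono power_mono) auto
  ultimately show ?thesis using sum_deg_le_Union[OF assms(1-3)] by linarith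
qed

text \<open>Choosing exactly \<open>t\<close> of the heavy vertices keeps the quadratic Bonferroni
  error fixed while their degree sum is already too large.\<close>

lemma few_heavy:
  assumes "\<F> \<subseteq> ksubsets n k" "2 \<le> k"
    and "2 * real (card \<F>) + (real t)\<^sup>2 * real ((n - 2) choose (k - 2)) < 2 * real t * \<theta>"
  shows "card {x \<in> {1..n}. \<theta> \<le> deg \<F> x} < t"
proof (rule ccontr)
  assume "\<not> ?thesis"
  then obtain T where T: "T \<subseteq> {x \<in> {1..n}. \<theta> \<le> deg \<F> x}" "card T = t"
    by (meson not_less obtain_subset_with_card_n)
  have fT: "finite T" using T(1) by (rule finite_subset) auto
  have "real t * \<theta> = (\<Sum>x\<in>T. \<theta>)" using T by simp
  also have "\<dots> \<le> (\<Sum>x\<in>T. deg \<F> x)" using T by (intro sum_mono) auto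
  finally show False using sum_deg_le[OF assms(1,2) fT, of "real t"] T assms(3) by simp
qed

lemma sum_sq_le:
  fixes f :: "'a \<Rightarrow> real"
  assumes "\<And>x. x \<in> X \<Longrightarrow> 0 \<le> f x" "\<And>x. x \<in> X \<Longrightarrow> f x \<le> b"
  shows "(\<Sum>x\<in>X. (f x)\<^sup>2) \<le> b * (\<Sum>x\<in>X. f x)"
  unfolding sum_distrib_left
  using assms by (intro sum_mono) (simp add: power2_eq_square mult_right_mono)

text \<open>Light vertices contribute at most m^2 / 4, since all degrees sum to k m. The heavy ones
  are so few that their degrees sum to little more than m; if all were below 2/3 m, their squares
  would not supply the remaining 3/4 m^2.\<close>

lemma concentrated_vertex:
  assumes F: "\<F> \<subseteq> ksubsets n k" and k: "2 \<le> k" and ne: "0 < card \<F>"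
    and big: "110 * (real k)\<^sup>2 * real ((n - 2) choose (k - 2)) \<le> real (card \<F>)"
    and sq: "(real (card \<F>))\<^sup>2 \<le> (\<Sum>x\<in>{1..n}. (deg \<F> x)\<^sup>2)"
  shows "\<exists>v\<in>{1..n}. 2 / 3 * real (card \<F>) \<le> deg \<F> v"
proof (rule ccontr)
  assume contra: "\<not> ?thesis"
  hence light: "deg \<F> x \<le> 2 / 3 * real (card \<F>)" if "x \<in> {1..n}" for x
    using that by (meson less_imp_le not_le)
  define m where "m = real (card \<F>)"
  define c where "c = real ((n - 2) choose (k - 2))"
  \<comment> \<open>As k \<theta> = m / 4, the tail is at most m^2 / 4 and Bonferroni leaves fewer
    than 5 k heavy vertices.\<close>
  define \<theta> where "\<theta> = m / (4 * real k)"
  define T where "T = {x \<in> {1..n}. \<theta> \<le> deg \<F> x}"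
  have m0: "m > 0" using ne by (simp add: m_def)
  have kc: "110 * (real k)\<^sup>2 * c \<le> m" using big by (simp add: c_def m_def)
  have k\<theta>: "real k * \<theta> = m / 4" using k by (simp add: \<theta>_def)
  have "2 * m + (real (5 * k))\<^sup>2 * c < 2 * real (5 * k) * \<theta>"
    using kc m0 k\<theta> by (simp add: power_mult_distrib)
  hence "card T < 5 * k"
    unfolding T_def using F k by (intro few_heavy) (auto simp: m_def c_def)
  hence "2 * (\<Sum>x\<in>T. deg \<F> x) \<le> 2 * m + (5 * real k)\<^sup>2 * c"
    unfolding m_def c_def by (intro sum_deg_le F k) (auto simp: T_def)
  hence sT: "(\<Sum>x\<in>T. deg \<F> x) \<le> m * (1 + 25/220)"
    using kc by (simp add: power_mult_distrib)
  have "(\<Sum>x\<in>T. (deg \<F> x)\<^sup>2) \<le> (2/3 * m) * (\<Sum>x\<in>T. deg \<F> x)"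
    by (intro sum_sq_le deg_nonneg) (simp_all add: m_def T_def light del: times_divide_eq_left)
  also have "\<dots> \<le> (2/3 * m) * (m * (1 + 25/220))"
    using sT m0 by (intro mult_left_mono) auto
  \<comment> \<open>The factor 2/3 (1 + 25/220) = 49/66 is just below 3/4.\<close>
  finally have 1: "(\<Sum>x\<in>T. (deg \<F> x)\<^sup>2) \<le> 49/66 * m\<^sup>2"
    by (simp add: power2_eq_square)
  have "(\<Sum>x\<in>{1..n} - T. (deg \<F> x)\<^sup>2) \<le> \<theta> * (\<Sum>x\<in>{1..n} - T. deg \<F> x)"
    by (intro sum_sq_le) (auto simp: T_def)
  also have "\<dots> \<le> \<theta> * (\<Sum>x\<in>{1..n}. deg \<F> x)"
    using m0 by (intro mult_left_mono sum_mono2) (auto simp: \<theta>_def)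
  also have "\<dots> = m\<^sup>2 / 4"
    unfolding sum_deg_ksubsets[OF F] m_def[symmetric] power2_eq_square
    using k\<theta> by (metis mult.assoc mult.commute times_divide_eq_right)
  finally have 2: "(\<Sum>x\<in>{1..n} - T. (deg \<F> x)\<^sup>2) \<le> m\<^sup>2 / 4" .
  have "(\<Sum>x\<in>{1..n}. (deg \<F> x)\<^sup>2) = (\<Sum>x\<in>T. (deg \<F> x)\<^sup>2) + (\<Sum>x\<in>{1..n} - T. (deg \<F> x)\<^sup>2)"
    by (subst sum.subset_diff[of T]) (auto simp: T_def)
  also have "\<dots> < m\<^sup>2" using 1 2 zero_less_power[OF m0, of 2] by linarith
  finally show False using sq by (simp add: m_def)
qed

lemma sum_indicator_mult:
  assumes "A \<subseteq> {1..n}"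
  shows "(\<Sum>x\<in>{1..n}. f x * deg {A} x) = (\<Sum>x\<in>A. f x)"
proof -
  have "(\<Sum>x\<in>{1..n}. f x * deg {A} x) = (\<Sum>x\<in>{1..n}. if x \<in> A then f x else 0)"
    by (rule sum.cong) (auto simp: deg_singleton)
  also have "\<dots> = (\<Sum>x\<in>{1..n} \<inter> A. f x)" by (simp add: sum.inter_restrict)
  finally show ?thesis using assms by (simp add: Int_absorb1)
qed

text \<open>Replacing \<open>A\<close> by \<open>B\<close> changes the total intersection by twice the difference of the
  degree sums plus \<open>card (A \<triangle> B)\<close>, so an optimal family is a strict threshold family for its own
  degrees.\<close>

lemma optimal_exchange:
  assumes F: "\<F> \<subseteq> ksubsets n k"
    and opt: "\<And>\<G>. \<G> \<subseteq> ksubsets n k \<Longrightarrow> card \<G> = card \<F> \<Longrightarrow> total_inter n \<G> \<le> total_inter n \<F>"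
    and A: "A \<in> \<F>" and B: "B \<in> ksubsets n k" "B \<notin> \<F>"
  shows "(\<Sum>x\<in>B. deg \<F> x) < (\<Sum>x\<in>A. deg \<F> x)"
proof -
  define \<G> where "\<G> = (\<F> - {A}) \<union> {B}"
  have fF: "finite \<F>" using F finite_ksubset_family by blast
  have "card (insert B (\<F> - {A})) = Suc (card (\<F> - {A}))"
    using fF B by (intro card_insert_disjoint) auto
  hence "card \<G> = card \<F>" using card_Suc_Diff1[OF fF A] by (simp only: \<G>_def Un_insert_right Un_empty_right)
  hence "total_inter n \<G> \<le> total_inter n \<F>"
    using F A B by (intro opt) (auto simp: \<G>_def)
  hence le: "real (total_inter n \<G>) \<le> real (total_inter n \<F>)" by (simp only: of_nat_le_iff)
  define e where "e x = deg {B} x - deg {A} x" for x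
  have AB: "A \<subseteq> {1..n}" "B \<subseteq> {1..n}" "A \<noteq> B" using A B F by (auto simp: ksubsets_def)
  have dG: "deg \<G> x = deg \<F> x + e x" for x
  proof -
    have "deg \<G> x = deg (\<F> - {A}) x + deg {B} x"
      unfolding \<G>_def using fF B by (intro deg_Un_disjoint) auto
    moreover have "deg ((\<F> - {A}) \<union> {A}) x = deg (\<F> - {A}) x + deg {A} x"
      using fF by (intro deg_Un_disjoint) auto
    moreover have "(\<F> - {A}) \<union> {A} = \<F>" using A by blast
    ultimately show ?thesis by (simp add: e_def)
  qed
  \<comment> \<open>A point where \<open>A\<close> and \<open>B\<close> differ makes the
    second-order term positive, which turns optimality into a strict inequality.\<close>
  obtain z where z: "z \<in> {1..n}" "(z \<in> A) \<noteq> (z \<in> B)" using AB by blast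
  have "(e z)\<^sup>2 = 1" using z(2) by (auto simp: e_def deg_singleton)
  moreover have "(e z)\<^sup>2 \<le> (\<Sum>x\<in>{1..n}. (e x)\<^sup>2)"
    using z(1) by (intro member_le_sum) auto
  ultimately have pos: "(\<Sum>x\<in>{1..n}. (e x)\<^sup>2) > 0" by linarith
  have "real (total_inter n \<G>) = (\<Sum>x\<in>{1..n}. (deg \<F> x)\<^sup>2 + 2 * (deg \<F> x * e x) + (e x)\<^sup>2)"
    unfolding total_inter_eq dG by (simp add: power2_sum algebra_simps)
  also have "\<dots> = real (total_inter n \<F>) + 2 * (\<Sum>x\<in>{1..n}. deg \<F> x * e x) + (\<Sum>x\<in>{1..n}. (e x)\<^sup>2)"
    unfolding total_inter_eq by (simp only: sum.distrib sum_distrib_left)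
  also have "(\<Sum>x\<in>{1..n}. deg \<F> x * e x) = (\<Sum>x\<in>B. deg \<F> x) - (\<Sum>x\<in>A. deg \<F> x)"
    unfolding e_def right_diff_distrib sum_subtractf
    by (simp only: sum_indicator_mult[OF AB(1)] sum_indicator_mult[OF AB(2)])
  finally show ?thesis using le pos by simp
qed

section \<open>Degrees and total intersection near the families \<open>hits\<close>\<close>

lemma link_disjoint_hits: "link n k r x \<inter> hits n k r = {}"
  by (auto simp: link_def hits_def)

lemma link_subset: "link n k r x \<subseteq> ksubsets n k"
  by (auto simp: link_def)

lemma finite_hits [simp]: "finite (hits n k r)"
  using finite_ksubset_family hits_subset by blast

lemma finite_link [simp]: "finite (link n k r x)"
  using finite_ksubset_family link_subset by blast

lemma hits_Suc: "hits n k (r + 1) = hits n k r \<union> link n k r (r + 1)"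
proof -
  have *: "{1..r + 1} = insert (r + 1) {1..r}" by auto
  show ?thesis unfolding hits_def link_def * by blast
qed

lemma hits_mono: "hits n k r \<subseteq> hits n k (r + 1)"
  unfolding hits_Suc by blast

lemma deg_hits_in:
  assumes "x \<in> {1..r}" "r \<le> n" "1 \<le> k"
  shows "deg (hits n k r) x = real ((n - 1) choose (k - 1))"
proof -
  have "star_fam (hits n k r) x = star_fam (ksubsets n k) x"
    using assms(1) unfolding star_fam_def hits_def by blast
  thus ?thesis using card_star_ksubsets[of x n k] assms by (simp add: deg_def)
qed

text \<open>The star of \<open>x\<close> in all k-sets splits into the sets meeting [r] and
  \<open>link n k r x\<close>, whose size does not depend on \<open>x\<close>. This constancy
  outside [r] drives both comparison formulas below.\<close>

lemma deg_hits_out: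
  assumes "x \<in> {r + 1..n}" "1 \<le> k"
  shows "deg (hits n k r) x
    = real ((n - 1) choose (k - 1)) - real ((n - (r + 1)) choose (k - 1))"
proof -
  have "star_fam (ksubsets n k) x = star_fam (hits n k r) x \<union> link n k r x"
    unfolding star_fam_def hits_def link_def by blast
  moreover have "star_fam (hits n k r) x \<inter> link n k r x = {}"
    using link_disjoint_hits unfolding star_fam_def by blast
  ultimately have "card (star_fam (ksubsets n k) x) = card (star_fam (hits n k r) x) + card (link n k r x)"
    by (simp add: card_Un_disjoint finite_star_fam)
  thus ?thesis using card_star_ksubsets[of x n k] card_link[of x r n k] assms
    by (simp add: deg_def)
qed

lemma deg_hits_out_le:
  assumes "x \<in> {r + 1..n}" "2 \<le> k"
  shows "deg (hits n k r) x \<le> real r * real ((n - 2) choose (k - 2))"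
proof -
  have "star_fam (hits n k r) x \<subseteq> (\<Union>y\<in>{1..r}. star_fam (hits n k r) x \<inter> star_fam (hits n k r) y)"
    unfolding star_fam_def hits_def by blast
  hence "card (star_fam (hits n k r) x)
      \<le> card (\<Union>y\<in>{1..r}. star_fam (hits n k r) x \<inter> star_fam (hits n k r) y)"
    by (intro card_mono) (auto simp: finite_star_fam)
  also have "\<dots> \<le> (\<Sum>y\<in>{1..r}. card (star_fam (hits n k r) x \<inter> star_fam (hits n k r) y))"
    by (intro card_UN_le) auto
  also have "\<dots> \<le> (\<Sum>y\<in>{1..r}. (n - 2) choose (k - 2))"
    using assms by (intro sum_mono codegree_le hits_subset) auto
  finally have "card (star_fam (hits n k r) x) \<le> r * ((n - 2) choose (k - 2))" by simp
  thus ?thesis unfolding deg_def by (metis of_nat_le_iff of_nat_mult)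
qed

lemma card_hits_le:
  assumes "r \<le> n" "1 \<le> k"
  shows "card (hits n k r) \<le> r * ((n - 1) choose (k - 1))"
proof -
  have "hits n k r = (\<Union>x\<in>{1..r}. star_fam (ksubsets n k) x)"
    unfolding star_fam_def hits_def by blast
  hence "card (hits n k r) \<le> (\<Sum>x\<in>{1..r}. card (star_fam (ksubsets n k) x))"
    using card_UN_le[of "{1..r}"] by simp
  also have "\<dots> = (\<Sum>x\<in>{1..r}. (n - 1) choose (k - 1))"
    using assms by (intro sum.cong refl card_star_ksubsets) auto
  finally show ?thesis by simp
qed

text \<open>The cross term sees \<open>\<H>\<close> only through its size: \<open>\<H>\<close> has
  degree zero on [r], and \<open>hits n k r\<close> has constant degree elsewhere. Surpluses of
  equal size are thus compared by their squared degrees alone.\<close>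

lemma total_inter_hits_Un:
  assumes H: "\<H> \<subseteq> ksubsets n k" "\<H> \<inter> hits n k r = {}" and k: "1 \<le> k" and r: "r < n"
  shows "real (total_inter n (hits n k r \<union> \<H>)) = (\<Sum>x\<in>{1..n}. (deg (hits n k r) x)\<^sup>2)
    + 2 * deg (hits n k r) (r + 1) * (real k * real (card \<H>)) + (\<Sum>x\<in>{1..n}. (deg \<H> x)\<^sup>2)"
proof -
  define D where "D = deg (hits n k r)"
  have fH: "finite \<H>" using H finite_ksubset_family by blast
  have mult: "D x * deg \<H> x = D (r + 1) * deg \<H> x" if "x \<in> {1..n}" for x
  proof (cases "x \<le> r")
    case True
    hence "x \<in> {1..r}" using that by simp
    hence "star_fam \<H> x = {}" using H unfolding star_fam_def hits_def by blast
    thus ?thesis by (simp add: deg_def)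
  next
    case False
    thus ?thesis using that r k by (simp add: D_def deg_hits_out)
  qed
  have "real (total_inter n (hits n k r \<union> \<H>))
      = (\<Sum>x\<in>{1..n}. (D x)\<^sup>2 + 2 * (D x * deg \<H> x) + (deg \<H> x)\<^sup>2)"
    unfolding total_inter_eq D_def using H(2) fH
    by (simp add: deg_Un_disjoint Int_commute power2_sum algebra_simps)
  also have "\<dots> = (\<Sum>x\<in>{1..n}. (D x)\<^sup>2 + 2 * (D (r + 1) * deg \<H> x) + (deg \<H> x)\<^sup>2)"
    using mult by (intro sum.cong refl) simp
  also have "\<dots> = (\<Sum>x\<in>{1..n}. (D x)\<^sup>2) + 2 * (D (r + 1) * (\<Sum>x\<in>{1..n}. deg \<H> x))
      + (\<Sum>x\<in>{1..n}. (deg \<H> x)\<^sup>2)"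
    by (simp only: sum.distrib sum_distrib_left)
  finally show ?thesis by (simp only: sum_deg_ksubsets[OF H(1)] D_def mult.assoc)
qed

text \<open>Degrees of \<open>hits n k s\<close> on [s] exceed the outer value by a constant, so the
  cross term also involves the degree sum of \<open>\<H>\<close> over [s]. That sum is least when
  every member meets [s] only once.\<close>

lemma total_inter_hits_Diff:
  assumes H: "\<H> \<subseteq> hits n k s" and k: "1 \<le> k" and s: "s < n"
  shows "real (total_inter n (hits n k s - \<H>)) = (\<Sum>x\<in>{1..n}. (deg (hits n k s) x)\<^sup>2)
    - 2 * deg (hits n k s) (s + 1) * (real k * real (card \<H>))
    - 2 * real ((n - (s + 1)) choose (k - 1)) * (\<Sum>x\<in>{1..s}. deg \<H> x)
    + (\<Sum>x\<in>{1..n}. (deg \<H> x)\<^sup>2)"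
proof -
  define D where "D = deg (hits n k s)"
  define Q where "Q = real ((n - (s + 1)) choose (k - 1))"
  have fH: "finite \<H>" and Hk: "\<H> \<subseteq> ksubsets n k"
    by (rule finite_subset[OF H finite_hits]) (rule order_trans[OF H hits_subset])
  have dd: "deg (hits n k s - \<H>) x = D x - deg \<H> x" for x
  proof -
    have "deg ((hits n k s - \<H>) \<union> \<H>) x = deg (hits n k s - \<H>) x + deg \<H> x"
      using fH by (intro deg_Un_disjoint) auto
    moreover have "(hits n k s - \<H>) \<union> \<H> = hits n k s" using H by blast
    ultimately show ?thesis by (simp add: D_def)
  qed
  have mult: "D x * deg \<H> x = D (s + 1) * deg \<H> x + Q * (if x \<in> {1..s} then deg \<H> x else 0)"
    if "x \<in> {1..n}" for x
  proof (cases "x \<le> s")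
    case True
    hence "D x = D (s + 1) + Q"
      using that s k by (simp add: D_def Q_def deg_hits_out deg_hits_in)
    thus ?thesis using True that by (simp add: algebra_simps)
  next
    case False
    thus ?thesis using that s k by (simp add: D_def deg_hits_out)
  qed
  have "real (total_inter n (hits n k s - \<H>))
      = (\<Sum>x\<in>{1..n}. (D x)\<^sup>2 - 2 * (D x * deg \<H> x) + (deg \<H> x)\<^sup>2)"
    unfolding total_inter_eq dd by (simp add: power2_diff algebra_simps)
  also have "\<dots> = (\<Sum>x\<in>{1..n}. (D x)\<^sup>2 - 2 * (D (s + 1) * deg \<H> x
      + Q * (if x \<in> {1..s} then deg \<H> x else 0)) + (deg \<H> x)\<^sup>2)"
    using mult by (intro sum.cong refl) simp
  also have "\<dots> = (\<Sum>x\<in>{1..n}. (D x)\<^sup>2) - 2 * (D (s + 1) * (\<Sum>x\<in>{1..n}. deg \<H> x)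
      + Q * (\<Sum>x\<in>{1..n}. if x \<in> {1..s} then deg \<H> x else 0)) + (\<Sum>x\<in>{1..n}. (deg \<H> x)\<^sup>2)"
    by (simp only: sum.distrib sum_subtractf sum_distrib_left[symmetric])
  also have "(\<Sum>x\<in>{1..n}. if x \<in> {1..s} then deg \<H> x else 0) = (\<Sum>x\<in>{1..n} \<inter> {1..s}. deg \<H> x)"
    by (rule sum.inter_restrict[symmetric]) simp
  also have "{1..n} \<inter> {1..s} = {1..s}" using s by auto
  finally show ?thesis by (simp only: sum_deg_ksubsets[OF Hk] D_def Q_def) (simp add: algebra_simps)
qed

lemma exists_degree_sorting:
  fixes d :: "nat \<Rightarrow> real"
  shows "\<exists>\<sigma>. \<sigma> permutes {1..n} \<and> (\<forall>x\<in>{1..n}. \<forall>y\<in>{1..n}. x \<le> y \<longrightarrow> d (\<sigma> y) \<le> d (\<sigma> x))"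
proof -
  define xs where "xs = sort_key (\<lambda>x. - d x) [1..<n + 1]"
  define \<sigma> where "\<sigma> i = (if i \<in> {1..n} then xs ! (i - 1) else i)" for i
  have len: "length xs = n" and dist: "distinct xs" and set: "set xs = {1..n}"
    by (auto simp: xs_def)
  have "bij_betw (\<lambda>i. xs ! i) {..<n} {1..n}"
    using bij_betw_nth[OF dist] len set by simp
  moreover have "bij_betw (\<lambda>i. i - 1) {1..n} {..<n}"
    by (rule bij_betw_byWitness[where f' = Suc]) auto
  ultimately have "bij_betw ((\<lambda>i. xs ! i) \<circ> (\<lambda>i. i - 1)) {1..n} {1..n}"
    using bij_betw_trans by blast
  hence "bij_betw \<sigma> {1..n} {1..n}"
    by (subst bij_betw_cong[where g = "(\<lambda>i. xs ! i) \<circ> (\<lambda>i. i - 1)"]) (auto simp: \<sigma>_def)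
  hence "\<sigma> permutes {1..n}"
    by (rule bij_imp_permutes) (auto simp: \<sigma>_def simp del: atLeastAtMost_iff)
  moreover have "d (\<sigma> y) \<le> d (\<sigma> x)" if "x \<in> {1..n}" "y \<in> {1..n}" "x \<le> y" for x y
  proof -
    have "sorted (map (\<lambda>x. - d x) xs)" by (simp add: xs_def)
    hence "map (\<lambda>x. - d x) xs ! (x - 1) \<le> map (\<lambda>x. - d x) xs ! (y - 1)"
      using that len by (intro sorted_nth_mono) auto
    thus ?thesis using that len by (auto simp: \<sigma>_def)
  qed
  ultimately show ?thesis by blast
qed

text \<open>The ratio of the two coefficients is (k - 1) / (n - 1), which is at most k / n.\<close>

lemma codegree_density:
  assumes "2 \<le> k" "k \<le> n"
  shows "real ((n - 2) choose (k - 2)) * real n \<le> real ((n - 1) choose (k - 1)) * real k"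
proof -
  obtain j where j: "k = Suc (Suc j)" using assms(1) by (metis add_2_eq_Suc le_Suc_ex)
  obtain l where l: "n = Suc (Suc l)" using assms by (metis add_2_eq_Suc le_Suc_ex le_trans)
  have jl: "real j \<le> real l" using assms by (simp add: j l)
  have "(1 + real j) * real (Suc l choose Suc j) = (1 + real l) * real (l choose j)"
    using Suc_times_binomial_eq[of l j] by (metis mult.commute of_nat_Suc of_nat_mult)
  hence eq: "real (Suc l choose Suc j) = (1 + real l) / (1 + real j) * real (l choose j)"
    by (simp add: field_simps)
  have "real (l choose j) * (2 + real l) \<le> real (l choose j) * ((1 + real l) / (1 + real j) * (2 + real j))"
    using jl by (intro mult_left_mono) (auto simp: field_simps)
  also have "\<dots> = real (Suc l choose Suc j) * (2 + real j)"
    by (simp only: eq mult_ac)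
  finally show ?thesis by (simp add: j l algebra_simps del: binomial_Suc_Suc)
qed

section \<open>Normalised degrees of a degree-sorted optimal family\<close>

text \<open>The range (0, 1] covers both alternatives for \<delta>; the finer range enters in
  \<open>between_hits\<close>. The constant 10^7 keeps errors such as 160801 R^4 K / n in
  \<open>heavy_set\<close> below 1/50.\<close>

locale extremal_family =
  fixes n k r :: nat and \<delta> :: real and \<F> :: "nat set set"
  assumes k2: "2 \<le> k"
    and n_large: "10 ^ 7 * (real r + 1) ^ 3 * real (k + r) * (real k)\<^sup>2 \<le> real n"
    and \<delta>_pos: "0 < \<delta>" and \<delta>_le_1: "\<delta> \<le> 1"
    and \<F>_subset: "\<F> \<subseteq> ksubsets n k"
    and card_\<F>: "real (card \<F>)
      = real (card (hits n k r)) + \<delta> * real ((n - (r + 1)) choose (k - 1))"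
    and optimal: "\<G> \<subseteq> ksubsets n k \<Longrightarrow> card \<G> = card \<F> \<Longrightarrow> total_inter n \<G> \<le> total_inter n \<F>"
    and sorted_deg: "x \<in> {1..n} \<Longrightarrow> y \<in> {1..n} \<Longrightarrow> x \<le> y \<Longrightarrow> deg \<F> y \<le> deg \<F> x"
begin

definition N :: real where "N = real ((n - 1) choose (k - 1))"
definition c :: real where "c = real ((n - 2) choose (k - 2))"
definition Q :: real where "Q = real ((n - (r + 1)) choose (k - 1))"
definition K :: real where "K = real k"
definition R :: real where "R = real r + 1"
definition q :: real where "q = real r + \<delta>"
definition a :: "nat \<Rightarrow> real" where "a x = deg \<F> x / N"

lemma K_ge: "2 \<le> K" using k2 by (simp add: K_def)
lemma R_ge: "1 \<le> R" by (simp add: R_def)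
lemma q_le: "q \<le> R" using \<delta>_le_1 by (simp add: q_def R_def)

text \<open>Since k + r = K + R - 1, this is the hypothesis on n. Of the instances below, R^4 K and
  R^3 K^3 serve the two levels of \<open>heavy_set\<close>, and (K + R - 1)^2 K serves
  \<open>weight_avoiding\<close>.\<close>

lemma n_bound:
  assumes "X \<le> R ^ 3 * (K + R - 1) * K\<^sup>2"
  shows "10 ^ 7 * X \<le> real n"
proof -
  have "10 ^ 7 * X \<le> 10 ^ 7 * (R ^ 3 * (K + R - 1) * K\<^sup>2)" using assms by simp
  also have "\<dots> \<le> real n" using n_large by (simp add: K_def R_def algebra_simps)
  finally show ?thesis .
qed

lemma n_bound_R4K: "10 ^ 7 * (R ^ 4 * K) \<le> real n"
proof (rule n_bound)
  have "R * K \<le> (K + R - 1) * K\<^sup>2"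
    using K_ge R_ge by (intro mult_mono) (auto simp: power2_eq_square)
  hence "R ^ 3 * (R * K) \<le> R ^ 3 * ((K + R - 1) * K\<^sup>2)" using R_ge by (intro mult_left_mono) auto
  thus "R ^ 4 * K \<le> R ^ 3 * (K + R - 1) * K\<^sup>2" by (simp add: eval_nat_numeral algebra_simps)
qed

lemma n_bound_R3K3: "10 ^ 7 * (R ^ 3 * K ^ 3) \<le> real n"
proof (rule n_bound)
  have "R ^ 3 * (K * K\<^sup>2) \<le> R ^ 3 * ((K + R - 1) * K\<^sup>2)"
    using R_ge by (intro mult_left_mono mult_right_mono) auto
  thus "R ^ 3 * K ^ 3 \<le> R ^ 3 * (K + R - 1) * K\<^sup>2" by (simp add: eval_nat_numeral algebra_simps)
qed

lemma n_bound_P2K: "10 ^ 7 * ((K + R - 1)\<^sup>2 * K) \<le> real n"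
proof (rule n_bound)
  have "0 \<le> (R - 1) * (K - 1)" using K_ge R_ge by simp
  hence "K + R - 1 \<le> R * K" by (simp add: algebra_simps)
  moreover have "R ^ 1 \<le> R ^ 3" using R_ge by (intro power_increasing) auto
  hence "R * K \<le> R ^ 3 * K" using K_ge by (intro mult_right_mono) auto
  ultimately have "K + R - 1 \<le> R ^ 3 * K" by (rule order_trans)
  hence "(K + R - 1) * ((K + R - 1) * K) \<le> (R ^ 3 * K) * ((K + R - 1) * K)"
    using K_ge R_ge by (intro mult_right_mono) auto
  thus "(K + R - 1)\<^sup>2 * K \<le> R ^ 3 * (K + R - 1) * K\<^sup>2"
    by (simp add: power2_eq_square algebra_simps)
qed

lemma RK_less_n: "10 ^ 7 * (R * K) \<le> real n"
proof -
  have "R ^ 1 * K ^ 1 \<le> R ^ 3 * K ^ 3"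
    using R_ge K_ge by (intro mult_mono power_increasing) auto
  thus ?thesis using n_bound_R3K3 by simp
qed

lemma n_pos: "0 < real n"
  using RK_less_n R_ge K_ge mult_mono[of 1 R 1 K] by simp

lemma r_k_less_n: "r < n" "k \<le> n"
proof -
  have "R * 1 \<le> R * K" "1 * K \<le> R * K"
    using R_ge K_ge by (intro mult_left_mono mult_right_mono; simp)+
  moreover from this have "R * K \<le> real n" using RK_less_n R_ge by simp
  ultimately have "R \<le> real n" "K \<le> real n" by simp_all
  thus "r < n" "k \<le> n" by (auto simp: R_def K_def)
qed

lemma k1: "1 \<le> k" using k2 by simp

lemma finite_\<F>: "finite \<F>" using \<F>_subset finite_ksubset_family by blast

lemma N_pos: "0 < N"
  unfolding N_def using r_k_less_n(2) by (simp add: zero_less_binomial)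

lemma c_nonneg: "0 \<le> c" by (simp add: c_def)

lemma c_le: "c \<le> N * (K / real n)"
  using codegree_density[OF k2 r_k_less_n(2)] n_pos
  by (simp add: c_def N_def K_def field_simps)

text \<open>N - Q is the degree of \<open>hits n k r\<close> at \<open>r + 1\<close>, hence
  nonnegative and at most r codegrees.\<close>

lemma Q_le: "Q \<le> N" and Q_ge: "N - real r * c \<le> Q"
  using deg_hits_out[of "r + 1" r n k] deg_nonneg[of "hits n k r" "r + 1"]
    deg_hits_out_le[of "r + 1" r n k] r_k_less_n k2
  by (auto simp: N_def Q_def c_def)

lemma Q_ge_N: "99 / 100 * N \<le> Q"
proof -
  have "real r * c \<le> R * (N * (K / real n))"
    using c_le c_nonneg by (intro mult_mono) (auto simp: R_def)
  also have "\<dots> = N * (R * K / real n)" by simp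
  also have "\<dots> \<le> N * (1 / 100)"
    using RK_less_n n_pos R_ge K_ge N_pos by (intro mult_left_mono) (auto simp: field_simps)
  finally show ?thesis using Q_ge by simp
qed

lemma Q_pos: "0 < Q" using Q_ge_N N_pos by linarith

lemma card_\<F>_le: "real (card \<F>) \<le> q * N"
proof -
  have "real (card (hits n k r)) \<le> real r * N"
    using card_hits_le[of r n k] r_k_less_n k1 unfolding N_def
    by (metis less_imp_le of_nat_le_iff of_nat_mult)
  moreover have "\<delta> * Q \<le> \<delta> * N" using Q_le \<delta>_pos by simp
  ultimately show ?thesis unfolding card_\<F> Q_def[symmetric] q_def by (simp add: algebra_simps)
qed

lemma a_nonneg: "0 \<le> a x" using N_pos by (simp add: a_def)

lemma a_le_1: "x \<in> {1..n} \<Longrightarrow> a x \<le> 1"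
proof -
  assume "x \<in> {1..n}"
  hence "deg \<F> x \<le> N"
    using deg_mono[OF finite_ksubsets \<F>_subset, of x] card_star_ksubsets[of x n k] k1
    by (simp add: deg_def N_def)
  thus "a x \<le> 1" using N_pos by (simp add: a_def)
qed

lemma a_sorted: "x \<in> {1..n} \<Longrightarrow> y \<in> {1..n} \<Longrightarrow> x \<le> y \<Longrightarrow> a y \<le> a x"
  using sorted_deg N_pos by (simp add: a_def divide_right_mono)

lemma a_exchange:
  assumes "A \<in> \<F>" "B \<in> ksubsets n k" "B \<notin> \<F>"
  shows "sum a B < sum a A"
proof -
  have "(\<Sum>x\<in>B. deg \<F> x) / N < (\<Sum>x\<in>A. deg \<F> x) / N"
    using optimal_exchange[OF \<F>_subset optimal assms] N_pos
    by (intro divide_strict_right_mono) auto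
  thus ?thesis by (simp add: a_def[abs_def] sum_divide_distrib)
qed

lemma sum_a_le:
  assumes "finite T" "real (card T) \<le> t"
  shows "2 * sum a T \<le> 2 * q + t\<^sup>2 * K / real n"
proof -
  have "2 * (\<Sum>x\<in>T. deg \<F> x) \<le> 2 * real (card \<F>) + t\<^sup>2 * c"
    unfolding c_def by (rule sum_deg_le[OF \<F>_subset k2 assms])
  also have "\<dots> \<le> 2 * (q * N) + t\<^sup>2 * (N * (K / real n))"
    using card_\<F>_le c_le by (intro add_mono mult_left_mono) auto
  finally have "2 * (\<Sum>x\<in>T. deg \<F> x) / N \<le> (2 * (q * N) + t\<^sup>2 * (N * (K / real n))) / N"
    using N_pos by (intro divide_right_mono) auto
  also have "\<dots> = 2 * q + t\<^sup>2 * K / real n" using N_pos by (simp add: add_divide_distrib)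
  also have "2 * (\<Sum>x\<in>T. deg \<F> x) / N = 2 * sum a T"
    by (simp add: a_def[abs_def] flip: sum_divide_distrib)
  finally show ?thesis .
qed

lemma few_heavy_a:
  assumes "2 * q + (real t)\<^sup>2 * K / real n < 2 * real t * \<eta>"
  shows "card {x \<in> {1..n}. \<eta> \<le> a x} < t"
proof -
  have "2 * real (card \<F>) + (real t)\<^sup>2 * c \<le> 2 * (q * N) + (real t)\<^sup>2 * (N * (K / real n))"
    using card_\<F>_le c_le by (intro add_mono mult_left_mono) auto
  also have "\<dots> = (2 * q + (real t)\<^sup>2 * K / real n) * N" by (simp add: algebra_simps)
  also have "\<dots> < 2 * real t * \<eta> * N" using assms N_pos by (intro mult_strict_right_mono)
  finally have "card {x \<in> {1..n}. \<eta> * N \<le> deg \<F> x} < t"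
    unfolding c_def by (intro few_heavy[OF \<F>_subset k2]) (simp add: mult.assoc)
  thus ?thesis using N_pos by (simp add: a_def pos_le_divide_eq)
qed

lemma sum_a_all: "sum a {1..n} \<le> K * q"
proof -
  have "sum a {1..n} = (\<Sum>x\<in>{1..n}. deg \<F> x) / N"
    by (simp add: a_def[abs_def] sum_divide_distrib)
  also have "\<dots> \<le> K * (q * N) / N"
    unfolding sum_deg_ksubsets[OF \<F>_subset] K_def[symmetric]
    using card_\<F>_le K_ge N_pos by (intro divide_right_mono mult_left_mono) auto
  finally show ?thesis using N_pos by simp
qed

subsection \<open>The competitor\<close>

definition m' :: nat where "m' = card \<F> - card (hits n k r)"

lemma m'_eq: "real m' = \<delta> * Q" and card_\<F>_eq: "card \<F> = card (hits n k r) + m'"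
proof -
  have "0 \<le> \<delta> * Q" using \<delta>_pos Q_pos by simp
  hence "card (hits n k r) \<le> card \<F>" using card_\<F> by (simp add: Q_def)
  thus "real m' = \<delta> * Q" "card \<F> = card (hits n k r) + m'"
    using card_\<F> by (auto simp: m'_def Q_def of_nat_diff)
qed

lemma m'_pos: "0 < m'" using m'_eq \<delta>_pos Q_pos by (metis of_nat_0_less_iff zero_less_mult_iff)

lemma card_link_eq: "real (card (link n k r (r + 1))) = Q"
  using card_link[of "r + 1" r n k] r_k_less_n k1 by (simp add: Q_def)

text \<open>Any choice of \<open>m'\<close> members works, since all of them contain
  \<open>r + 1\<close> and avoid [r].\<close>

definition \<G> :: "nat set set" where
  "\<G> = (SOME \<G>. \<G> \<subseteq> link n k r (r + 1) \<and> card \<G> = m')"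

lemma \<G>_subset: "\<G> \<subseteq> link n k r (r + 1)" and card_\<G>: "card \<G> = m'"
proof -
  have "real m' \<le> real (card (link n k r (r + 1)))"
    unfolding card_link_eq m'_eq using \<delta>_le_1 Q_pos by simp
  then obtain X where "X \<subseteq> link n k r (r + 1)" "card X = m'"
    by (metis obtain_subset_with_card_n of_nat_le_iff)
  hence "\<exists>X. X \<subseteq> link n k r (r + 1) \<and> card X = m'" by blast
  from someI_ex[OF this] show "\<G> \<subseteq> link n k r (r + 1)" "card \<G> = m'"
    by (auto simp: \<G>_def)
qed

lemma finite_\<G>: "finite \<G>" using \<G>_subset finite_link by (rule finite_subset)

lemma \<G>_disjoint: "\<G> \<inter> hits n k r = {}" using \<G>_subset link_disjoint_hits by blast

lemma \<G>_ksubsets: "\<G> \<subseteq> ksubsets n k" using \<G>_subset link_subset by blast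

lemma competitor: "total_inter n (hits n k r \<union> \<G>) \<le> total_inter n \<F>"
proof (rule optimal)
  show "hits n k r \<union> \<G> \<subseteq> ksubsets n k" using \<G>_ksubsets hits_subset by blast
  show "card (hits n k r \<union> \<G>) = card \<F>"
    using \<G>_disjoint finite_\<G> by (simp add: card_Un_disjoint Int_commute card_\<G> card_\<F>_eq)
qed

lemma deg_\<G>_center: "deg \<G> (r + 1) = real m'"
proof -
  have "star_fam \<G> (r + 1) = \<G>" using \<G>_subset by (auto simp: star_fam_def link_def)
  thus ?thesis by (simp add: deg_def card_\<G>)
qed

text \<open>The competitor has degree at least N on [r] and at least \<delta> N at
  \<open>r + 1\<close>; optimality passes its sum of squares on to \<open>\<F>\<close>.\<close>

lemma sum_a_sq_ge: "real r + \<delta>\<^sup>2 \<le> (\<Sum>x\<in>{1..n}. (a x)\<^sup>2)"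
proof -
  define g where "g = deg (hits n k r \<union> \<G>)"
  have g: "g x = deg (hits n k r) x + deg \<G> x" for x
    unfolding g_def using \<G>_disjoint finite_\<G> by (intro deg_Un_disjoint) (auto simp: Int_commute)
  have g1: "N \<le> g x" if "x \<in> {1..r}" for x
    using that deg_hits_in[of x r n k] r_k_less_n k1 by (simp add: g N_def)
  have "g (r + 1) = N - Q + \<delta> * Q"
    using deg_hits_out[of "r + 1" r n k] r_k_less_n k1 deg_\<G>_center
    by (simp add: g N_def Q_def m'_eq)
  moreover have "0 \<le> (1 - \<delta>) * (N - Q)" using \<delta>_le_1 Q_le by simp
  ultimately have g2: "\<delta> * N \<le> g (r + 1)" by (simp add: algebra_simps)
  have "real r * N\<^sup>2 + (\<delta> * N)\<^sup>2 = (\<Sum>x\<in>{1..r}. N\<^sup>2) + (\<delta> * N)\<^sup>2" by simp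
  also have "\<dots> \<le> (\<Sum>x\<in>{1..r}. (g x)\<^sup>2) + (g (r + 1))\<^sup>2"
    using g1 g2 N_pos \<delta>_pos by (intro add_mono sum_mono power_mono) auto
  also have "\<dots> = (\<Sum>x\<in>{1..r + 1}. (g x)\<^sup>2)" by simp
  also have "\<dots> \<le> (\<Sum>x\<in>{1..n}. (g x)\<^sup>2)" using r_k_less_n by (intro sum_mono2) auto
  also have "\<dots> = real (total_inter n (hits n k r \<union> \<G>))" by (simp add: total_inter_eq g_def)
  also have "\<dots> \<le> real (total_inter n \<F>)" using competitor by simp
  also have "\<dots> = N\<^sup>2 * (\<Sum>x\<in>{1..n}. (a x)\<^sup>2)"
    using N_pos by (simp add: total_inter_eq a_def power_divide flip: sum_divide_distrib)
  finally have "N\<^sup>2 * (real r + \<delta>\<^sup>2) \<le> N\<^sup>2 * (\<Sum>x\<in>{1..n}. (a x)\<^sup>2)"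
    by (simp add: power_mult_distrib algebra_simps)
  thus ?thesis using N_pos by simp
qed

text \<open>Cutting the vertices at the two degree levels \<open>N / (200 R)\<close> and \<open>N / (100 k R)\<close>
  leaves a tail of total squared degree at most \<open>N\<^sup>2 / 50\<close>. The Bonferroni bound is
  applied to at most \<open>O(R\<^sup>2)\<close> vertices at the first level and at most \<open>O(k R\<^sup>2)\<close> at
  the second; a single level would need \<open>n\<close> larger than assumed when \<open>k\<close> and \<open>r\<close> are comparable.\<close>

lemma heavy_set:
  obtains T where "{1..r + 1} \<subseteq> T" "finite T" "sum a T \<le> q + 1 / 50"
    "real r + \<delta>\<^sup>2 - 1 / 50 \<le> (\<Sum>x\<in>T. (a x)\<^sup>2)"
proof -
  define \<eta>1 where "\<eta>1 = 1 / (200 * R)"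
  define \<eta>2 where "\<eta>2 = 1 / (100 * K * R)"
  \<comment> \<open>Both counts satisfy t \<eta> = 2 R. As q \<le> R, \<open>few_heavy_a\<close>
    applies while the Bonferroni error stays below 2 R.\<close>
  define t1 :: nat where "t1 = 400 * (r + 1)\<^sup>2"
  define t2 :: nat where "t2 = 200 * k * (r + 1)\<^sup>2"
  define T1 where "T1 = {x \<in> {1..n}. \<eta>1 \<le> a x}"
  define T2 where "T2 = {x \<in> {1..n}. \<eta>2 \<le> a x}"
  define T where "T = T1 \<union> {1..r + 1}"
  have RK: "0 < R" "0 < K" using R_ge K_ge by auto
  have t1: "real t1 = 400 * R\<^sup>2" by (simp add: t1_def R_def)
  have t2: "real t2 = 200 * K * R\<^sup>2" by (simp add: t2_def R_def K_def)
  have e1: "R ^ 4 * K / real n \<le> 1 / 10 ^ 7"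
    using n_bound_R4K n_pos by (simp add: field_simps)
  have e2: "R ^ 3 * K ^ 3 / real n \<le> 1 / 10 ^ 7"
    using n_bound_R3K3 n_pos by (simp add: field_simps)
  have t1sq: "(real t1)\<^sup>2 * K / real n = 160000 * (R ^ 4 * K / real n)"
    by (simp add: t1 power_mult_distrib)
  have "(real t1)\<^sup>2 * K / real n \<le> 1 / 50" unfolding t1sq using e1 by simp
  moreover have "2 * real t1 * \<eta>1 = 4 * R"
    using RK by (simp add: t1 \<eta>1_def power2_eq_square)
  ultimately have c1: "card T1 < t1"
    unfolding T1_def using q_le R_ge by (intro few_heavy_a) linarith
  \<comment> \<open>This has one factor R more than \<open>n_bound_R3K3\<close> controls; the
    resulting error R / 250 is harmless against 2 R.\<close>
  have t2sq: "(real t2)\<^sup>2 * K / real n = 40000 * (R * (R ^ 3 * K ^ 3 / real n))"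
    by (simp add: t2 power_mult_distrib eval_nat_numeral)
  have "R * (R ^ 3 * K ^ 3 / real n) \<le> R * (1 / 10000000)"
    using e2 RK by (intro mult_left_mono) auto
  hence t2sq_le: "(real t2)\<^sup>2 * K / real n \<le> R / 250" unfolding t2sq using R_ge by linarith
  have "2 * real t2 * \<eta>2 = 4 * R"
    using RK by (simp add: t2 \<eta>2_def power2_eq_square)
  hence c2: "card T2 < t2"
    unfolding T2_def using t2sq_le q_le R_ge by (intro few_heavy_a) linarith
  have fin: "finite T" "finite T2" by (auto simp: T_def T1_def T2_def)
  have Tn: "T \<subseteq> {1..n}" using r_k_less_n by (auto simp: T_def T1_def)
  have "card T \<le> card T1 + (r + 1)" unfolding T_def using card_Un_le[of T1 "{1..r + 1}"] by simp
  hence "real (card T) \<le> real t1 + R" using c1 by (simp add: R_def)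
  also have "\<dots> \<le> 401 * R\<^sup>2" using R_ge mult_mono[of 1 R R R] by (simp add: t1 power2_eq_square)
  finally have "2 * sum a T \<le> 2 * q + (401 * R\<^sup>2)\<^sup>2 * K / real n"
    by (rule sum_a_le[OF fin(1)])
  also have "(401 * R\<^sup>2)\<^sup>2 * K / real n = 160801 * (R ^ 4 * K / real n)"
    by (simp add: power_mult_distrib)
  finally have sT: "sum a T \<le> q + 1 / 50" using e1 by simp
  have "2 * sum a T2 \<le> 2 * q + (real t2)\<^sup>2 * K / real n"
    using c2 by (intro sum_a_le fin(2)) simp
  hence sT2: "sum a T2 \<le> 2 * R" using t2sq_le q_le R_ge by linarith
  \<comment> \<open>Vertices of \<open>U - T\<close> lie below \<eta>1 and have degree sum at most 2
    R; those outside \<open>U\<close> lie below \<eta>2 and are controlled by the total K q.\<close>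
  define U where "U = T \<union> T2"
  have Un: "U \<subseteq> {1..n}" using Tn by (auto simp: U_def T2_def)
  have "(\<Sum>x\<in>U - T. (a x)\<^sup>2) \<le> \<eta>1 * sum a (U - T)"
    using Un by (intro sum_sq_le a_nonneg) (auto simp: T_def T1_def)
  also have "\<dots> \<le> \<eta>1 * sum a T2"
    using RK fin a_nonneg by (intro mult_left_mono sum_mono2) (auto simp: U_def \<eta>1_def)
  also have "\<dots> \<le> \<eta>1 * (2 * R)" using sT2 RK by (intro mult_left_mono) (auto simp: \<eta>1_def)
  also have "\<dots> = 1 / 100" using RK by (simp add: \<eta>1_def)
  finally have m1: "(\<Sum>x\<in>U - T. (a x)\<^sup>2) \<le> 1 / 100" .
  have "(\<Sum>x\<in>{1..n} - U. (a x)\<^sup>2) \<le> \<eta>2 * sum a ({1..n} - U)"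
    by (intro sum_sq_le a_nonneg) (auto simp: U_def T2_def)
  also have "\<dots> \<le> \<eta>2 * sum a {1..n}"
    using RK a_nonneg by (intro mult_left_mono sum_mono2) (auto simp: \<eta>2_def)
  also have "\<dots> \<le> \<eta>2 * (K * R)"
  proof (intro mult_left_mono)
    have "K * q \<le> K * R" using q_le RK by simp
    thus "sum a {1..n} \<le> K * R" using sum_a_all by linarith
  qed (use RK in \<open>auto simp: \<eta>2_def\<close>)
  also have "\<dots> = 1 / 100" using RK by (simp add: \<eta>2_def)
  finally have m2: "(\<Sum>x\<in>{1..n} - U. (a x)\<^sup>2) \<le> 1 / 100" .
  have "(\<Sum>x\<in>{1..n}. (a x)\<^sup>2) = (\<Sum>x\<in>{1..n} - U. (a x)\<^sup>2) + (\<Sum>x\<in>U. (a x)\<^sup>2)"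
    using Un by (intro sum.subset_diff) auto
  also have "(\<Sum>x\<in>U. (a x)\<^sup>2) = (\<Sum>x\<in>U - T. (a x)\<^sup>2) + (\<Sum>x\<in>T. (a x)\<^sup>2)"
    using fin by (intro sum.subset_diff) (auto simp: U_def)
  finally have "real r + \<delta>\<^sup>2 - 1 / 50 \<le> (\<Sum>x\<in>T. (a x)\<^sup>2)"
    using m1 m2 sum_a_sq_ge by simp
  thus thesis using that[of T] sT fin by (simp add: T_def)
qed

section \<open>Deficit on [r] and the coarse inclusions\<close>

definition p :: real where "p = real r - sum a {1..r}"

text \<open>With b = a (r + 1), every x in [r] satisfies (a x - b) (1 - a x) \<ge> 0, and outside
  [r] a x \<le> b. When both enter the square sum of \<open>heavy_set\<close>, the products b p
  cancel.\<close>

lemma deficit_bounds: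
  shows "p \<le> a (r + 1) * (\<delta> + 1 / 50) - \<delta>\<^sup>2 + 1 / 50"
    and "a (r + 1) \<le> \<delta> + 1 / 50 + p"
proof -
  obtain T where T: "{1..r + 1} \<subseteq> T" "finite T" "sum a T \<le> q + 1 / 50"
    "real r + \<delta>\<^sup>2 - 1 / 50 \<le> (\<Sum>x\<in>T. (a x)\<^sup>2)"
    by (rule heavy_set)
  define b where "b = a (r + 1)"
  have b0: "0 \<le> b" by (simp add: b_def a_nonneg)
  have sub: "{1..r} \<subseteq> T" using T(1) by auto
  have split: "sum f T = sum f (T - {1..r}) + sum f {1..r}" for f :: "nat \<Rightarrow> real"
    using T(2) sub by (rule sum.subset_diff[rotated])
  have out: "a x \<le> b" if "x \<notin> {1..r}" for x
  proof (cases "x \<in> {1..n}")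
    case True
    thus ?thesis unfolding b_def using that r_k_less_n by (intro a_sorted) auto
  next
    \<comment> \<open>\<open>heavy_set\<close> does not place \<open>T\<close> inside {1..n}; a
      point outside has degree 0.\<close>
    case False
    hence "star_fam \<F> x = {}" using \<F>_subset unfolding star_fam_def ksubsets_def by blast
    thus ?thesis using b0 by (simp add: a_def deg_def)
  qed
  have "(\<Sum>x\<in>{1..r}. (a x)\<^sup>2) \<le> (\<Sum>x\<in>{1..r}. (1 + b) * a x - b)"
  proof (intro sum_mono)
    fix x assume x: "x \<in> {1..r}"
    hence "b \<le> a x" unfolding b_def using r_k_less_n by (intro a_sorted) auto
    moreover have "a x \<le> 1" using x r_k_less_n by (intro a_le_1) auto
    ultimately have "0 \<le> (a x - b) * (1 - a x)" by simp
    thus "(a x)\<^sup>2 \<le> (1 + b) * a x - b" by (simp add: power2_eq_square algebra_simps)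
  qed
  also have "\<dots> = (1 + b) * (real r - p) - real r * b"
    by (simp add: sum_subtractf p_def flip: sum_distrib_left)
  finally have 1: "(\<Sum>x\<in>{1..r}. (a x)\<^sup>2) \<le> (1 + b) * (real r - p) - real r * b" .
  have "(\<Sum>x\<in>T - {1..r}. (a x)\<^sup>2) \<le> b * sum a (T - {1..r})"
    using out by (intro sum_sq_le a_nonneg) auto
  also have sd: "sum a (T - {1..r}) \<le> \<delta> + 1 / 50 + p"
    using split[of a] T(3) by (simp add: p_def q_def)
  hence "b * sum a (T - {1..r}) \<le> b * (\<delta> + 1 / 50 + p)" using b0 by (rule mult_left_mono)
  finally have 2: "(\<Sum>x\<in>T - {1..r}. (a x)\<^sup>2) \<le> b * (\<delta> + 1 / 50 + p)" .
  have "real r + \<delta>\<^sup>2 - 1 / 50 \<le> b * (\<delta> + 1 / 50 + p) + ((1 + b) * (real r - p) - real r * b)"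
    using T(4) 1 2 split[of "\<lambda>x. (a x)\<^sup>2"] by simp
  also have "\<dots> = real r - p + b * (\<delta> + 1 / 50)" by (simp add: algebra_simps)
  finally show "p \<le> a (r + 1) * (\<delta> + 1 / 50) - \<delta>\<^sup>2 + 1 / 50" by (simp add: b_def)
  have "b \<le> sum a (T - {1..r})"
    unfolding b_def using T(1,2) a_nonneg by (intro member_le_sum) auto
  thus "a (r + 1) \<le> \<delta> + 1 / 50 + p" using sd by (simp add: b_def)
qed

lemma p_nonneg: "0 \<le> p"
proof -
  have "sum a {1..r} \<le> (\<Sum>x\<in>{1..r}. 1)" using r_k_less_n by (intro sum_mono a_le_1) auto
  thus ?thesis by (simp add: p_def)
qed

lemma deficit_ge: "x \<in> {1..r} \<Longrightarrow> 1 - a x \<le> p"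
proof -
  assume x: "x \<in> {1..r}"
  have "1 - a x \<le> (\<Sum>x\<in>{1..r}. 1 - a x)"
    using x r_k_less_n a_le_1 by (intro member_le_sum[of x "{1..r}" "\<lambda>x. 1 - a x"]) auto
  thus ?thesis by (simp add: p_def sum_subtractf)
qed

text \<open>Bonferroni on the k + s \<le> 2 (K + R - 1) vertices of \<open>A\<close> and [s]: both
  share the total q, so \<open>A\<close> is light when [s] is nearly saturated.\<close>

lemma weight_avoiding:
  assumes "A \<in> ksubsets n k" "A \<inter> {1..s} = {}" "s \<le> r + 1"
  shows "sum a A + sum a {1..s} \<le> q + 1 / 50"
proof -
  have fA: "finite A" and cA: "card A = k"
    using assms(1) finite_subset[of A "{1..n}"] by (auto simp: ksubsets_def)
  have "card (A \<union> {1..s}) = k + s" using fA cA assms(2) by (simp add: card_Un_disjoint)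
  hence "real (card (A \<union> {1..s})) \<le> 2 * (K + R - 1)"
    using assms(3) K_ge by (simp add: K_def R_def)
  hence "2 * sum a (A \<union> {1..s}) \<le> 2 * q + (2 * (K + R - 1))\<^sup>2 * K / real n"
    using fA by (intro sum_a_le) auto
  also have "(2 * (K + R - 1))\<^sup>2 * K / real n = 4 * ((K + R - 1)\<^sup>2 * K / real n)"
    by (simp only: power_mult_distrib) simp
  also have "(K + R - 1)\<^sup>2 * K / real n \<le> 1 / 100"
    using n_bound_P2K n_pos by (simp add: field_simps)
  finally show ?thesis using fA assms(2) by (simp add: sum.union_disjoint)
qed

text \<open>A missing \<open>B\<close> meeting [r] weighs at least 1 - p \<ge> 9/10, while sets
  avoiding [r] weigh at most \<delta> + 1/50 + p \<le> 31/50. So \<open>\<F>\<close> would lie in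
  \<open>hits n k r - {B}\<close>, which is too small.\<close>

lemma hits_subset_\<F>_if_small:
  assumes "\<delta> \<le> 1 / 2"
  shows "hits n k r \<subseteq> \<F>"
proof (rule ccontr)
  assume "\<not> ?thesis"
  then obtain B where B: "B \<in> hits n k r" "B \<notin> \<F>" by blast
  define b where "b = a (r + 1)"
  have d1: "p \<le> b * (\<delta> + 1 / 50) - \<delta>\<^sup>2 + 1 / 50" and d2: "b \<le> \<delta> + 1 / 50 + p"
    unfolding b_def by (rule deficit_bounds)+
  \<comment> \<open>Substituting the second bound into the first leaves p on the right with
    coefficient \<delta> + 1/50 \<le> 13/25, so it can be absorbed.\<close>
  have "b * (\<delta> + 1 / 50) \<le> (\<delta> + 1 / 50 + p) * (\<delta> + 1 / 50)"
    using d2 \<delta>_pos by (intro mult_right_mono) auto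
  hence "p \<le> (\<delta> + 1 / 50 + p) * (\<delta> + 1 / 50) - \<delta>\<^sup>2 + 1 / 50" using d1 by linarith
  hence "p \<le> p * (\<delta> + 1 / 50) + \<delta> / 25 + 1 / 50 + 1 / 2500"
    by (simp add: power2_eq_square algebra_simps)
  moreover have "p * (\<delta> + 1 / 50) \<le> p * (1 / 2 + 1 / 50)"
    using assms p_nonneg by (intro mult_left_mono) auto
  ultimately have p: "p \<le> 1 / 10" using assms by simp
  have "\<F> \<subseteq> hits n k r - {B}"
  proof
    fix A assume A: "A \<in> \<F>"
    have less: "sum a B < sum a A"
      using B A hits_subset by (intro a_exchange) auto
    have "A \<in> hits n k r"
    proof (rule ccontr)
      assume "A \<notin> hits n k r"
      hence "A \<inter> {1..r} = {}" "A \<in> ksubsets n k" using A \<F>_subset by (auto simp: hits_def)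
      hence 1: "sum a A \<le> q + 1 / 50 - sum a {1..r}" using weight_avoiding[of A r] by simp
      obtain x where x: "x \<in> B" "x \<in> {1..r}" using B(1) unfolding hits_def by blast
      have "finite B" using B(1) finite_subset[of B "{1..n}"] by (auto simp: hits_def ksubsets_def)
      hence "a x \<le> sum a B" using x a_nonneg by (intro member_le_sum) auto
      thus False using less 1 deficit_ge[OF x(2)] p assms by (simp add: p_def q_def)
    qed
    thus "A \<in> hits n k r - {B}" using less by auto
  qed
  hence "card \<F> \<le> card (hits n k r - {B})" by (intro card_mono) auto
  also have "\<dots> < card (hits n k r)" using B(1) by (intro psubset_card_mono) auto
  finally show False using card_\<F>_eq by simp
qed

text \<open>A member avoiding [r + 1] weighs at most \<delta> + 1/50 + p - b < b, while every set
  meeting [r + 1] weighs at least b. So \<open>\<F>\<close> would contain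
  \<open>hits n k (r + 1)\<close> and one more set, exceeding its size.\<close>

lemma \<F>_subset_hits_if_large:
  assumes "1 / 2 \<le> \<delta>"
  shows "\<F> \<subseteq> hits n k (r + 1)"
proof (rule ccontr)
  assume "\<not> ?thesis"
  then obtain A where A: "A \<in> \<F>" "A \<notin> hits n k (r + 1)" by blast
  define b where "b = a (r + 1)"
  have d1: "p \<le> b * (\<delta> + 1 / 50) - \<delta>\<^sup>2 + 1 / 50" unfolding b_def by (rule deficit_bounds)
  have "0 \<le> (\<delta> - 1 / 2) * (\<delta> + 1 / 2)" using assms by simp
  hence sq: "1 / 4 \<le> \<delta>\<^sup>2" by (simp add: power2_eq_square algebra_simps)
  moreover have "\<delta>\<^sup>2 - 1 / 50 \<le> b * (\<delta> + 1 / 50)" using d1 p_nonneg by linarith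
  ultimately have b: "(\<delta>\<^sup>2 - 1 / 50) / (\<delta> + 1 / 50) \<le> b"
    using assms by (simp add: divide_le_eq)
  \<comment> \<open>By the first deficit bound it suffices that \<delta> + 1/50 - (\<delta>^2 -
    1/50) < (2 - \<delta> - 1/50) b. The lower bound for b gives this because (\<delta> + 1/50)^2 <
    2 (\<delta>^2 - 1/50).\<close>
  have p: "p < 2 * b - \<delta> - 1 / 50"
  proof -
    have "(\<delta> + 1 / 50) * (\<delta> + 1 / 50) < 2 * (\<delta>\<^sup>2 - 1 / 50)"
      using sq \<delta>_le_1 by (simp add: power2_eq_square algebra_simps)
    hence "(\<delta> + 1 / 50) < 2 * (\<delta>\<^sup>2 - 1 / 50) / (\<delta> + 1 / 50)"
      using assms by (simp add: less_divide_eq)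
    moreover have "(2 - \<delta> - 1 / 50) * ((\<delta>\<^sup>2 - 1 / 50) / (\<delta> + 1 / 50)) \<le> (2 - \<delta> - 1 / 50) * b"
      using b \<delta>_le_1 by (intro mult_left_mono) auto
    moreover have "(2 - \<delta> - 1 / 50) * ((\<delta>\<^sup>2 - 1 / 50) / (\<delta> + 1 / 50))
        = 2 * (\<delta>\<^sup>2 - 1 / 50) / (\<delta> + 1 / 50) - (\<delta>\<^sup>2 - 1 / 50)"
      using assms by (simp add: field_simps)
    ultimately have "\<delta> + 1 / 50 - (\<delta>\<^sup>2 - 1 / 50) < (2 - \<delta> - 1 / 50) * b" by linarith
    thus ?thesis using d1 by (simp add: algebra_simps)
  qed
  have "A \<inter> {1..r + 1} = {}" "A \<in> ksubsets n k"
    using A \<F>_subset unfolding hits_def by (blast, blast)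
  hence 1: "sum a A + sum a {1..r + 1} \<le> q + 1 / 50" using weight_avoiding[of A "r + 1"] by simp
  have "sum a {1..r + 1} = real r - p + b" by (simp add: p_def b_def)
  hence sA: "sum a A < b" using 1 p by (simp add: q_def)
  have "insert A (hits n k (r + 1)) \<subseteq> \<F>"
  proof -
    have "B \<in> \<F>" if B: "B \<in> hits n k (r + 1)" for B
    proof (rule ccontr)
      assume "B \<notin> \<F>"
      hence less: "sum a B < sum a A" using A(1) B hits_subset by (intro a_exchange) auto
      obtain x where x: "x \<in> B" "x \<in> {1..r + 1}" using B unfolding hits_def by blast
      have "finite B" using B finite_subset[of B "{1..n}"] by (auto simp: hits_def ksubsets_def)
      hence "a x \<le> sum a B" using x a_nonneg by (intro member_le_sum) auto
      moreover have "b \<le> a x" unfolding b_def using x(2) r_k_less_n by (intro a_sorted) auto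
      ultimately show False using less sA by linarith
    qed
    thus ?thesis using A(1) by blast
  qed
  hence "card (insert A (hits n k (r + 1))) \<le> card \<F>" using finite_\<F> by (intro card_mono)
  hence "real (card (hits n k (r + 1))) + 1 \<le> real (card \<F>)" using A(2) by simp
  moreover have "real (card (hits n k (r + 1))) = real (card (hits n k r)) + Q"
    using card_hits_Suc[of r n k] r_k_less_n k1 by (simp add: Q_def)
  moreover have "\<delta> * Q \<le> 1 * Q" using \<delta>_le_1 Q_pos by (intro mult_right_mono) auto
  ultimately show False using card_\<F> unfolding Q_def[symmetric] by linarith
qed

section \<open>Fine inclusions through the surplus and the missing part\<close>

lemma deg_hits_Suc_out_le:
  assumes "x \<in> {r + 2..n}"
  shows "deg (hits n k (r + 1)) x \<le> R * c"
  using deg_hits_out_le[of x "r + 1" n k] assms k2 by (simp add: R_def c_def add.commute)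

lemma card_hits_Suc_eq: "real (card (hits n k (r + 1))) = real (card (hits n k r)) + Q"
  using card_hits_Suc[of r n k] r_k_less_n k1 by (simp add: Q_def)

text \<open>The surplus has at least the squared degrees of the star \<open>\<G>\<close>, and
  sorting puts a heavy vertex at \<open>r + 1\<close>. A member \<open>A\<close> avoiding [r + 1]
  would have to outweigh that vertex, and Bonferroni leaves no room for both.\<close>

lemma \<F>_subset_hits:
  assumes sub: "hits n k r \<subseteq> \<F>" and big: "110 * K\<^sup>2 * c \<le> real m'"
  shows "\<F> \<subseteq> hits n k (r + 1)"
proof (rule ccontr)
  assume "\<not> ?thesis"
  then obtain A where A: "A \<in> \<F>" "A \<notin> hits n k (r + 1)" by blast
  define \<F>' where "\<F>' = \<F> - hits n k r"
  define f where "f = deg \<F>'"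
  have \<F>': "\<F>' \<subseteq> ksubsets n k" "\<F>' \<inter> hits n k r = {}" "\<F> = hits n k r \<union> \<F>'"
    using sub \<F>_subset by (auto simp: \<F>'_def)
  have fin: "finite \<F>'" using finite_\<F> by (simp add: \<F>'_def)
  have card': "card \<F>' = m'"
    using sub by (simp add: \<F>'_def card_Diff_subset card_\<F>_eq)
  have d: "deg \<F> x = deg (hits n k r) x + f x" for x
    using deg_Un_disjoint[of "hits n k r" \<F>' x] \<F>' fin by (simp add: f_def Int_commute)
  have "(real m')\<^sup>2 = (deg \<G> (r + 1))\<^sup>2" by (simp only: deg_\<G>_center)
  also have "\<dots> \<le> (\<Sum>x\<in>{1..n}. (deg \<G> x)\<^sup>2)"
    using r_k_less_n by (intro member_le_sum) auto
  also have "\<dots> \<le> (\<Sum>x\<in>{1..n}. (f x)\<^sup>2)"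
  proof -
    have "real (total_inter n (hits n k r \<union> \<G>)) \<le> real (total_inter n (hits n k r \<union> \<F>'))"
      using competitor \<F>'(3) by simp
    thus ?thesis
      unfolding total_inter_hits_Un[OF \<G>_ksubsets \<G>_disjoint k1 r_k_less_n(1)]
        total_inter_hits_Un[OF \<F>'(1,2) k1 r_k_less_n(1)] card' card_\<G> f_def by simp
  qed
  finally have "\<exists>v\<in>{1..n}. 2 / 3 * real (card \<F>') \<le> deg \<F>' v"
    using big m'_pos by (intro concentrated_vertex[OF \<F>'(1) k2]) (auto simp: card' f_def K_def c_def)
  then obtain v where v: "v \<in> {1..n}" "2 / 3 * real m' \<le> f v"
    by (auto simp: card' f_def)
  have "v \<notin> {1..r}"
  proof
    assume "v \<in> {1..r}"
    hence "star_fam \<F>' v = {}" using \<F>' unfolding star_fam_def hits_def by blast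
    hence "f v = 0" by (simp add: f_def deg_def)
    thus False using v(2) m'_pos by simp
  qed
  hence vr: "v \<in> {r + 1..n}" using v(1) by auto
  have hits_const: "deg (hits n k r) x = N - Q" if "x \<in> {r + 1..n}" for x
    using that k1 by (simp add: deg_hits_out N_def Q_def)
  \<comment> \<open>\<open>hits n k r\<close> has constant degree outside [r], so there the order of
    degrees in \<open>\<F>\<close> is the order of \<open>f\<close>.\<close>
  have "deg \<F> v \<le> deg \<F> (r + 1)" using vr by (intro sorted_deg) auto
  hence center: "2 / 3 * real m' \<le> f (r + 1)"
    using v(2) vr r_k_less_n by (simp add: d hits_const)
  have Ak: "A \<in> ksubsets n k" using A(1) \<F>_subset by blast
  have Ar: "A \<inter> {1..r + 1} = {}" using A(2) Ak unfolding hits_def by blast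
  have A': "A \<in> \<F>'" using A hits_mono by (auto simp: \<F>'_def)
  \<comment> \<open>The surplus has m' \<le> Q members and one of them, \<open>A\<close>, lies
    outside this star of size Q.\<close>
  have "\<not> link n k r (r + 1) \<subseteq> \<F>"
  proof
    assume "link n k r (r + 1) \<subseteq> \<F>"
    hence "link n k r (r + 1) \<subseteq> \<F>' - {A}"
      using link_disjoint_hits[of n k r "r + 1"] Ar by (auto simp: \<F>'_def link_def)
    hence "card (link n k r (r + 1)) \<le> card (\<F>' - {A})" using fin by (intro card_mono) auto
    also have "\<dots> < card \<F>'" using fin A' by (intro psubset_card_mono) auto
    finally have "Q < real m'" using card_link_eq card' by simp
    thus False using m'_eq \<delta>_le_1 Q_pos by simp
  qed
  then obtain B where B: "B \<in> link n k r (r + 1)" "B \<notin> \<F>" by blast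
  have sum_d: "(\<Sum>x\<in>X. deg \<F> x) = real k * (N - Q) + sum f X"
    if "X \<in> ksubsets n k" "X \<inter> {1..r} = {}" for X
  proof -
    have "X \<subseteq> {r + 1..n}" using that avoid_iff[of X n r] by (simp add: ksubsets_def)
    hence "(\<Sum>x\<in>X. deg \<F> x) = (\<Sum>x\<in>X. (N - Q) + f x)"
      by (intro sum.cong) (auto simp: d hits_const)
    thus ?thesis using that by (simp add: sum.distrib ksubsets_def)
  qed
  have Bk: "B \<in> ksubsets n k" "B \<inter> {1..r} = {}" "r + 1 \<in> B" using B(1) by (auto simp: link_def)
  have "A \<inter> {1..r} = {}" using Ar by auto
  hence "sum f B < sum f A"
    using optimal_exchange[OF \<F>_subset optimal A(1) Bk(1) B(2)] sum_d[OF Bk(1,2)] sum_d[OF Ak] by simp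
  moreover have "finite A" "finite B" using Ak Bk(1) finite_subset[of _ "{1..n}"] by (auto simp: ksubsets_def)
  moreover from this have "f (r + 1) \<le> sum f B"
    using Bk(3) by (intro member_le_sum) (auto simp: f_def)
  ultimately have less: "f (r + 1) < sum f A" and fA: "finite A" by auto
  have "r + 1 \<notin> A" using Ar by auto
  hence sum_ins: "sum f (insert (r + 1) A) = f (r + 1) + sum f A"
    and "card (insert (r + 1) A) = k + 1"
    using fA Ak by (auto simp: ksubsets_def)
  hence "2 * sum f (insert (r + 1) A) \<le> 2 * real m' + (2 * K)\<^sup>2 * c"
    unfolding f_def c_def card'[symmetric] using fA k2
    by (intro sum_deg_le \<F>'(1)) (auto simp: K_def)
  \<comment> \<open>The left side exceeds 8/3 m', while the right side is at most (2 + 4/110)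
    m'.\<close>
  hence "2 * (f (r + 1) + sum f A) \<le> 2 * real m' + 4 * (K\<^sup>2 * c)"
    unfolding sum_ins by (simp add: power_mult_distrib)
  moreover have "0 < real m'" using m'_pos by simp
  moreover have "K\<^sup>2 * c \<le> real m' / 110" using big by simp
  ultimately show False using less center by argo
qed

text \<open>The complementary argument for the missing part. Weights now involve vertices outside
  [r + 1], of degree at most R c, hence the factor R in the size condition.\<close>

lemma hits_subset_\<F>:
  assumes sub: "\<F> \<subseteq> hits n k (r + 1)" and \<delta>1: "\<delta> < 1"
    and big: "110 * K\<^sup>2 * (R * c) \<le> (1 - \<delta>) * Q"
  shows "hits n k r \<subseteq> \<F>"
proof (rule ccontr)
  assume "\<not> ?thesis"
  then obtain A where A: "A \<in> hits n k r" "A \<notin> \<F>" by blast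
  define \<H> where "\<H> = hits n k (r + 1) - \<F>"
  \<comment> \<open>The missing part of the competitor: each member meets [r + 1] only in
    \<open>r + 1\<close>, so its degree sum over [r + 1] is the least possible.\<close>
  define \<H>\<^sub>G where "\<H>\<^sub>G = link n k r (r + 1) - \<G>"
  define h where "h = deg \<H>"
  define m where "m = real (card \<H>)"
  have rn: "r + 1 < n"
  proof -
    have "2 * (R * 1) \<le> 10 ^ 7 * (R * K)" using R_ge K_ge by (intro mult_mono) auto
    hence "2 * R \<le> real n" using RK_less_n by linarith
    thus ?thesis by (simp add: R_def)
  qed
  have \<H>: "\<H> \<subseteq> hits n k (r + 1)" "hits n k (r + 1) - \<H> = \<F>"
    using sub by (auto simp: \<H>_def)
  have \<H>k: "\<H> \<subseteq> ksubsets n k" using \<H>(1) hits_subset by blast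
  have fin: "finite \<H>" by (simp add: \<H>_def)
  have card_\<H>: "card \<H> = card (hits n k (r + 1)) - card \<F>"
    using sub finite_\<F> by (simp add: \<H>_def card_Diff_subset)
  have "card \<F> \<le> card (hits n k (r + 1))" using sub by (intro card_mono) auto
  hence "m = real (card (hits n k (r + 1))) - real (card \<F>)"
    unfolding m_def card_\<H> by (simp add: of_nat_diff)
  also have "\<dots> = (1 - \<delta>) * Q"
    unfolding card_hits_Suc_eq card_\<F> Q_def[symmetric] by (simp add: algebra_simps)
  finally have m: "m = (1 - \<delta>) * Q" .
  have m_pos: "0 < m" unfolding m using \<delta>1 Q_pos by simp
  have Rc: "0 \<le> R * c" using R_ge c_nonneg by simp
  have bigm: "110 * K\<^sup>2 * (R * c) \<le> m" using big m by simp
  have \<H>\<^sub>G: "\<H>\<^sub>G \<subseteq> hits n k (r + 1)" "hits n k (r + 1) - \<H>\<^sub>G = hits n k r \<union> \<G>"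
    using \<G>_subset link_disjoint_hits[of n k r "r + 1"] unfolding hits_Suc \<H>\<^sub>G_def by blast+
  have "card \<H>\<^sub>G = card (link n k r (r + 1)) - m'"
    unfolding \<H>\<^sub>G_def using \<G>_subset finite_\<G> by (simp add: card_Diff_subset card_\<G>)
  moreover have "m' \<le> card (link n k r (r + 1))"
    using card_mono[OF finite_link \<G>_subset] by (simp add: card_\<G>)
  ultimately have "real (card \<H>\<^sub>G) = Q - real m'"
    using card_link_eq by (simp add: of_nat_diff)
  hence mG: "real (card \<H>\<^sub>G) = m" unfolding m m'_eq by (simp add: algebra_simps)
  have fin_G: "finite \<H>\<^sub>G" by (simp add: \<H>\<^sub>G_def)
  have "(\<Sum>x\<in>{1..r + 1}. deg \<H>\<^sub>G x) = (\<Sum>X\<in>\<H>\<^sub>G. real (card (X \<inter> {1..r + 1})))"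
    using fin_G by (intro sum_deg) auto
  also have "\<dots> = (\<Sum>X\<in>\<H>\<^sub>G. 1)"
  proof (intro sum.cong refl)
    fix X assume "X \<in> \<H>\<^sub>G"
    hence "r + 1 \<in> X" "X \<inter> {1..r} = {}" by (auto simp: \<H>\<^sub>G_def link_def)
    moreover have "{1..r + 1} = insert (r + 1) {1..r}" by auto
    ultimately have "X \<inter> {1..r + 1} = {r + 1}" by (metis Int_insert_right_if1)
    thus "real (card (X \<inter> {1..r + 1})) = 1" by simp
  qed
  finally have sG: "(\<Sum>x\<in>{1..r + 1}. deg \<H>\<^sub>G x) = m" using mG by simp
  have "m = (\<Sum>X\<in>\<H>. 1)" by (simp add: m_def)
  also have "\<dots> \<le> (\<Sum>X\<in>\<H>. real (card (X \<inter> {1..r + 1})))"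
  proof (intro sum_mono)
    fix X assume "X \<in> \<H>"
    hence "X \<inter> {1..r + 1} \<noteq> {}" using \<H>(1) unfolding hits_def by blast
    hence "0 < card (X \<inter> {1..r + 1})" by (simp only: card_gt_0_iff finite_Int finite_atLeastAtMost simp_thms)
    thus "1 \<le> real (card (X \<inter> {1..r + 1}))" by linarith
  qed
  also have "\<dots> = (\<Sum>x\<in>{1..r + 1}. h x)"
    unfolding h_def using fin by (intro sum_deg[symmetric]) auto
  finally have sH: "m \<le> (\<Sum>x\<in>{1..r + 1}. h x)" .
  have "deg \<H>\<^sub>G (r + 1) = m"
  proof -
    have "star_fam \<H>\<^sub>G (r + 1) = \<H>\<^sub>G" by (auto simp: star_fam_def \<H>\<^sub>G_def link_def)
    thus ?thesis by (simp add: deg_def mG)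
  qed
  hence "m\<^sup>2 = (deg \<H>\<^sub>G (r + 1))\<^sup>2" by simp
  also have "\<dots> \<le> (\<Sum>x\<in>{1..n}. (deg \<H>\<^sub>G x)\<^sup>2)"
    using rn by (intro member_le_sum) auto
  also have "\<dots> \<le> (\<Sum>x\<in>{1..n}. (h x)\<^sup>2)"
  proof -
    \<comment> \<open>The linear term counts against \<open>\<F>\<close>: its missing part has
      degree sum at least m over [r + 1], with equality for the competitor. Optimality thus still
      compares the squares.\<close>
    define Q' where "Q' = real ((n - (r + 1 + 1)) choose (k - 1))"
    have "Q' * m \<le> Q' * (\<Sum>x\<in>{1..r + 1}. h x)" using sH by (intro mult_left_mono) (auto simp: Q'_def)
    moreover have "real (total_inter n (hits n k (r + 1) - \<H>\<^sub>G)) \<le> real (total_inter n (hits n k (r + 1) - \<H>))"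
      using competitor \<H>(2) \<H>\<^sub>G(2) by simp
    ultimately show ?thesis
      unfolding total_inter_hits_Diff[OF \<H>(1) k1 rn] total_inter_hits_Diff[OF \<H>\<^sub>G(1) k1 rn]
        mG m_def[symmetric] sG Q'_def[symmetric] h_def by linarith
  qed
  finally have "(real (card \<H>))\<^sup>2 \<le> (\<Sum>x\<in>{1..n}. (deg \<H> x)\<^sup>2)" by (simp add: m_def h_def)
  moreover have "1 * c \<le> R * c" using R_ge c_nonneg by (intro mult_right_mono) auto
  hence "110 * K\<^sup>2 * (1 * c) \<le> 110 * K\<^sup>2 * (R * c)" by (intro mult_left_mono) auto
  hence "110 * K\<^sup>2 * c \<le> real (card \<H>)" using bigm by (simp add: m_def)
  moreover have "0 < card \<H>" using m_pos by (simp add: m_def)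
  ultimately obtain v where v: "v \<in> {1..n}" "2 / 3 * m \<le> h v"
    using concentrated_vertex[OF \<H>k k2] by (auto simp: m_def h_def K_def c_def)
  have K4: "4 * (R * c) \<le> K\<^sup>2 * (R * c)"
    using K_ge Rc mult_mono[of 2 K 2 K] by (intro mult_right_mono) (auto simp: power2_eq_square)
  have d: "deg \<F> x = deg (hits n k (r + 1)) x - h x" for x
  proof -
    have "deg (\<F> \<union> \<H>) x = deg \<F> x + deg \<H> x"
      using finite_\<F> fin by (intro deg_Un_disjoint) (auto simp: \<H>_def)
    moreover have "\<F> \<union> \<H> = hits n k (r + 1)" using \<H> by blast
    ultimately show ?thesis by (simp add: h_def)
  qed
  have d_in: "deg \<F> x = N - h x" if "x \<in> {1..r + 1}" for x
    using deg_hits_in[OF that _ k1, of n] rn by (simp add: d N_def)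
  have d_out: "deg \<F> x \<le> R * c" if "x \<in> {r + 2..n}" for x
    using deg_mono[OF finite_hits sub, of x] deg_hits_Suc_out_le[OF that] by linarith
  have "v \<in> {1..r + 1}"
  proof (rule ccontr)
    assume "v \<notin> {1..r + 1}"
    hence "v \<in> {r + 2..n}" using v(1) by auto
    hence "h v \<le> R * c"
      using deg_mono[OF finite_hits \<H>(1), of v] deg_hits_Suc_out_le[of v] by (simp add: h_def)
    thus False using v(2) K4 bigm m_pos by linarith
  qed
  \<comment> \<open>On [r + 1] the degree in \<open>\<F>\<close> is N - h, so sorting makes
    \<open>h\<close> largest at \<open>r + 1\<close>.\<close>
  moreover from this have "deg \<F> (r + 1) \<le> deg \<F> v" using rn by (intro sorted_deg) auto
  ultimately have center: "2 / 3 * m \<le> h (r + 1)" using v(2) by (simp add: d_in)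
  have A\<H>: "A \<in> \<H>" using A hits_mono by (auto simp: \<H>_def)
  obtain u where u: "u \<in> A" "u \<in> {1..r}" using A(1) unfolding hits_def by blast
  have "\<not> link n k r (r + 1) \<subseteq> \<H>"
  proof
    assume "link n k r (r + 1) \<subseteq> \<H>"
    hence "card (link n k r (r + 1)) \<le> card \<H>" using fin by (intro card_mono)
    hence "Q \<le> m" using card_link_eq by (simp add: m_def)
    thus False unfolding m using \<delta>_pos Q_pos by simp
  qed
  then obtain B where B: "B \<in> link n k r (r + 1)" "B \<notin> \<H>" by blast
  hence B\<F>: "B \<in> \<F>" using hits_Suc by (auto simp: \<H>_def)
  have Ak: "A \<in> ksubsets n k" using A(1) hits_subset by blast
  have less: "(\<Sum>x\<in>A. deg \<F> x) < (\<Sum>x\<in>B. deg \<F> x)"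
    using optimal_exchange[OF \<F>_subset optimal B\<F> Ak A(2)] by simp
  have Bk: "B \<in> ksubsets n k" "B \<inter> {1..r} = {}" "r + 1 \<in> B" using B(1) by (auto simp: link_def)
  have finAB: "finite A" "finite B"
    using Ak Bk(1) finite_subset[of _ "{1..n}"] by (auto simp: ksubsets_def)
  have "deg \<F> u \<le> (\<Sum>x\<in>A. deg \<F> x)" using u finAB by (intro member_le_sum) auto
  hence 1: "N - h u \<le> (\<Sum>x\<in>A. deg \<F> x)" using u(2) by (simp add: d_in)
  have "B \<subseteq> {r + 1..n}" using Bk avoid_iff[of B n r] by (simp add: ksubsets_def)
  hence B_out: "x \<in> {r + 2..n}" if "x \<in> B - {r + 1}" for x
    using that by (auto simp: le_less Suc_le_eq)
  have "(\<Sum>x\<in>B. deg \<F> x) = deg \<F> (r + 1) + (\<Sum>x\<in>B - {r + 1}. deg \<F> x)"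
    using finAB(2) Bk(3) by (rule sum.remove)
  also have "(\<Sum>x\<in>B - {r + 1}. deg \<F> x) \<le> (\<Sum>x\<in>B - {r + 1}. R * c)"
    using B_out by (intro sum_mono d_out)
  also have "\<dots> = (K - 1) * (R * c)"
    using Bk finAB k1 by (simp add: ksubsets_def K_def of_nat_diff)
  finally have 2: "(\<Sum>x\<in>B. deg \<F> x) \<le> N - h (r + 1) + (K - 1) * (R * c)"
    using d_in[of "r + 1"] by simp
  have "2 * (\<Sum>x\<in>{u, r + 1}. h x) \<le> 2 * m + 2\<^sup>2 * c"
    unfolding h_def m_def c_def using u(2) by (intro sum_deg_le \<H>k k2) auto
  moreover have "u \<noteq> r + 1" using u(2) by auto
  ultimately have 3: "h u + h (r + 1) \<le> m + 2 * c" by simp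
  have "(K - 1) * (R * c) + 2 * c \<le> (K + 1) * (R * c)"
    using \<open>1 * c \<le> R * c\<close> by (simp add: algebra_simps)
  also have "\<dots> \<le> K\<^sup>2 * (R * c)"
  proof (intro mult_right_mono Rc)
    have "2 * K \<le> K * K" using K_ge by (intro mult_right_mono) auto
    thus "K + 1 \<le> K\<^sup>2" unfolding power2_eq_square using K_ge by linarith
  qed
  \<comment> \<open>Together these give 2 h (r + 1) < m + K^2 R c \<le> (1 + 1/110) m, against h (r
    + 1) \<ge> 2/3 m.\<close>
  finally show False using 1 2 3 less center bigm m_pos by linarith
qed

text \<open>Each half of the range of \<delta> yields one inclusion coarsely, and the density
  condition then yields the other; at \<delta> = 1 equal sizes suffice.\<close>

theorem between_hits:
  assumes "(150 * K ^ 3 * R\<^sup>2 / real n \<le> \<delta> \<and> \<delta> \<le> 1 - 150 * K ^ 3 * R ^ 3 / real n) \<or> \<delta> = 1"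
  shows "hits n k r \<subseteq> \<F> \<and> \<F> \<subseteq> hits n k (r + 1)"
proof -
  \<comment> \<open>The gap between 150 and 110 pays for replacing N by Q, as 110/150 \<le>
    99/100.\<close>
  have density: "110 * K\<^sup>2 * (X * c) \<le> \<epsilon> * Q" if "150 * K ^ 3 * X / real n \<le> \<epsilon>" "0 \<le> X" for X \<epsilon>
  proof -
    have "110 * K\<^sup>2 * (X * c) \<le> 110 * K\<^sup>2 * (X * (N * (K / real n)))"
      using c_le that by (intro mult_left_mono) auto
    also have "\<dots> = 110 / 150 * (150 * K ^ 3 * X / real n) * N"
      by (simp add: eval_nat_numeral)
    also have "\<dots> \<le> 99 / 100 * (150 * K ^ 3 * X / real n) * N"
      using that K_ge N_pos n_pos by (intro mult_right_mono) auto
    also have "\<dots> = (150 * K ^ 3 * X / real n) * (99 / 100 * N)" by simp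
    also have "\<dots> \<le> \<epsilon> * Q"
    proof (intro mult_mono that(1) Q_ge_N)
      have "0 \<le> 150 * K ^ 3 * X / real n" using that K_ge n_pos by simp
      thus "0 \<le> \<epsilon>" using that(1) by linarith
    qed (use N_pos in auto)
    finally show ?thesis .
  qed
  have R1: "1 * c \<le> R\<^sup>2 * c" "R * c \<le> R ^ 3 * c"
    using R_ge c_nonneg power_increasing[of 1 3 R] one_le_power[of R 2]
    by (intro mult_right_mono; simp)+
  consider "\<delta> \<le> 1 / 2" | "1 / 2 \<le> \<delta>" "\<delta> = 1" | "1 / 2 \<le> \<delta>" "\<delta> \<noteq> 1" by linarith
  thus ?thesis
  proof cases
    case 1
    have sub: "hits n k r \<subseteq> \<F>" using 1 by (rule hits_subset_\<F>_if_small)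
    have "110 * K\<^sup>2 * (R\<^sup>2 * c) \<le> \<delta> * Q" using assms 1 by (intro density) auto
    moreover have "110 * K\<^sup>2 * (1 * c) \<le> 110 * K\<^sup>2 * (R\<^sup>2 * c)" using R1 by (intro mult_left_mono) auto
    ultimately have "110 * K\<^sup>2 * c \<le> real m'" by (simp add: m'_eq)
    thus ?thesis using sub \<F>_subset_hits by blast
  next
    case 2
    have sub: "\<F> \<subseteq> hits n k (r + 1)" using 2 by (intro \<F>_subset_hits_if_large)
    have "real (card \<F>) = real (card (hits n k (r + 1)))"
      unfolding card_hits_Suc_eq card_\<F> Q_def using 2 by simp
    hence "\<F> = hits n k (r + 1)" using sub by (intro card_subset_eq) auto
    thus ?thesis using hits_mono by blast
  next
    case 3
    have sub: "\<F> \<subseteq> hits n k (r + 1)" using 3 by (intro \<F>_subset_hits_if_large)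
    have "110 * K\<^sup>2 * (R ^ 3 * c) \<le> (1 - \<delta>) * Q" using assms 3 R_ge by (intro density) auto
    moreover have "110 * K\<^sup>2 * (R * c) \<le> 110 * K\<^sup>2 * (R ^ 3 * c)" using R1 by (intro mult_left_mono) auto
    ultimately show ?thesis using sub hits_subset_\<F> 3 \<delta>_le_1 by (meson less_le order_trans)
  qed
qed

end

subsection \<open>Relabelling\<close>

lemma deg_relabel:
  assumes "\<sigma> permutes {1..n}"
  shows "deg (image (inv \<sigma>) ` \<F>) x = deg \<F> (\<sigma> x)"
proof -
  have "inj (image (inv \<sigma>))"
    using permutes_inj[OF permutes_inv[OF assms]] by (simp add: inj_image_eq_iff inj_on_def)
  moreover have "x \<in> inv \<sigma> ` A \<longleftrightarrow> \<sigma> x \<in> A" for A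
    using permutes_inverses[OF assms] by (metis image_iff)
  hence "star_fam (image (inv \<sigma>) ` \<F>) x = image (inv \<sigma>) ` star_fam \<F> (\<sigma> x)"
    unfolding star_fam_def by blast
  ultimately show ?thesis by (simp add: deg_def card_image inj_on_subset)
qed

lemma total_inter_relabel:
  assumes "\<sigma> permutes {1..n}"
  shows "total_inter n (image (inv \<sigma>) ` \<F>) = total_inter n \<F>"
proof -
  have "real (total_inter n (image (inv \<sigma>) ` \<F>)) = (\<Sum>x\<in>{1..n}. (deg \<F> (\<sigma> x))\<^sup>2)"
    by (simp add: total_inter_eq deg_relabel[OF assms])
  also have "\<dots> = real (total_inter n \<F>)"
    unfolding total_inter_eq using sum.permute[OF assms, of "\<lambda>x. (deg \<F> x)\<^sup>2"] by (simp add: o_def)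
  finally show ?thesis by simp
qed

theorem theorem1p2:
  shows "\<exists>C0::real. C0 \<ge> 3000 \<and>
    (\<forall>k r n (\<delta>::real) \<F>.
       k \<ge> 2 \<longrightarrow>
       real n \<ge> C0 * (real r + 1)^3 * real (k + r) * (real k)^2 \<longrightarrow>
       ((150 * (real k)^3 * (real r + 1)^2 / real n \<le> \<delta> \<and>
         \<delta> \<le> 1 - 150 * (real k)^3 * (real r + 1)^3 / real n) \<or> \<delta> = 1) \<longrightarrow>
       \<F> \<subseteq> ksubsets n k \<longrightarrow>
       real (card \<F>) = (\<Sum>i=1..r. real ((n - i) choose (k - 1)))
                          + \<delta> * real ((n - (r + 1)) choose (k - 1)) \<longrightarrow>
       total_inter n \<F> = max_total_inter n k \<F> \<longrightarrow>
       (\<exists>\<sigma>. \<sigma> permutes {1..n} \<and>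
          lex_fam n k 1 r \<subseteq> (image \<sigma>) ` \<F> \<and>
          (image \<sigma>) ` \<F> \<subseteq> lex_fam n k 1 (r + 1)))"
proof (intro exI[of _ "10 ^ 7"] conjI allI impI)
  fix k r n :: nat and \<delta> :: real and \<F> :: "nat set set"
  assume k: "k \<ge> 2"
    and n: "real n \<ge> 10 ^ 7 * (real r + 1)^3 * real (k + r) * (real k)^2"
    and \<delta>: "(150 * (real k)^3 * (real r + 1)^2 / real n \<le> \<delta> \<and>
         \<delta> \<le> 1 - 150 * (real k)^3 * (real r + 1)^3 / real n) \<or> \<delta> = 1"
    and F: "\<F> \<subseteq> ksubsets n k"
    and size: "real (card \<F>) = (\<Sum>i=1..r. real ((n - i) choose (k - 1)))
                          + \<delta> * real ((n - (r + 1)) choose (k - 1))"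
    and max: "total_inter n \<F> = max_total_inter n k \<F>"
  have nkr: "2 * (k + r) \<le> n"
  proof -
    have "2 * 1 * real (k + r) * 1 \<le> 10 ^ 7 * (real r + 1)^3 * real (k + r) * (real k)^2"
      using k by (intro mult_mono one_le_power) auto
    thus ?thesis using n by linarith
  qed
  have opt: "total_inter n \<G> \<le> total_inter n \<F>" if "\<G> \<subseteq> ksubsets n k" "card \<G> = card \<F>" for \<G>
  proof -
    have "finite {total_inter n \<G> | \<G>. \<G> \<subseteq> ksubsets n k \<and> card \<G> = card \<F>}"
      by (rule finite_subset[of _ "total_inter n ` Pow (ksubsets n k)"]) auto
    thus ?thesis unfolding max max_total_inter_def by (rule Max_ge) (use that in blast)
  qed
  obtain \<sigma> where \<sigma>: "\<sigma> permutes {1..n}"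
    "\<forall>x\<in>{1..n}. \<forall>y\<in>{1..n}. x \<le> y \<longrightarrow> deg \<F> (\<sigma> y) \<le> deg \<F> (\<sigma> x)"
    using exists_degree_sorting by blast
  \<comment> \<open>Relabelling by the inverse gives x the degree of \<sigma> x, which the sorting
    made nonincreasing.\<close>
  define \<tau> where "\<tau> = inv \<sigma>"
  have \<tau>: "\<tau> permutes {1..n}" unfolding \<tau>_def by (rule permutes_inv[OF \<sigma>(1)])
  have inj: "inj \<tau>" using permutes_inj[OF \<tau>] .
  have card1: "card (image \<tau> ` \<F>) = card \<F>"
    using inj by (intro card_image) (simp add: inj_image_eq_iff inj_on_def)
  have sub1: "image \<tau> ` \<F> \<subseteq> ksubsets n k"
  proof
    fix B assume "B \<in> image \<tau> ` \<F>"
    then obtain A where A: "B = \<tau> ` A" "A \<in> \<F>" by blast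
    hence "A \<subseteq> {1..n}" "card A = k" using F by (auto simp: ksubsets_def)
    moreover have "card (\<tau> ` A) = card A" using inj by (intro card_image) (rule inj_on_subset, auto)
    moreover have "\<tau> ` A \<subseteq> \<tau> ` {1..n}" using calculation(1) by (rule image_mono)
    ultimately show "B \<in> ksubsets n k" using permutes_image[OF \<tau>] by (simp add: A(1) ksubsets_def)
  qed
  have "0 < real n" using nkr k by simp
  hence "0 < 150 * (real k)^3 * (real r + 1)^2 / real n" "0 < 150 * (real k)^3 * (real r + 1)^3 / real n"
    using k by auto
  hence \<delta>01: "0 < \<delta>" "\<delta> \<le> 1" using \<delta> by linarith+
  interpret extremal_family n k r \<delta> "image \<tau> ` \<F>"
  proof
    show "2 \<le> k" "0 < \<delta>" "\<delta> \<le> 1" by fact+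
    show "10 ^ 7 * (real r + 1) ^ 3 * real (k + r) * (real k)\<^sup>2 \<le> real n" by (fact n)
    show "image \<tau> ` \<F> \<subseteq> ksubsets n k" by (fact sub1)
    show "real (card (image \<tau> ` \<F>))
        = real (card (hits n k r)) + \<delta> * real ((n - (r + 1)) choose (k - 1))"
      unfolding card1 size using card_hits_sum[of r n k] nkr k by simp
    show "total_inter n \<G> \<le> total_inter n (image \<tau> ` \<F>)"
      if "\<G> \<subseteq> ksubsets n k" "card \<G> = card (image \<tau> ` \<F>)" for \<G>
      using opt[OF that(1)] that(2) unfolding card1 by (simp add: \<tau>_def total_inter_relabel[OF \<sigma>(1)])
    show "deg (image \<tau> ` \<F>) y \<le> deg (image \<tau> ` \<F>) x"
      if "x \<in> {1..n}" "y \<in> {1..n}" "x \<le> y" for x y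
      unfolding \<tau>_def deg_relabel[OF \<sigma>(1)] using \<sigma>(2) that by blast
  qed
  have "hits n k r \<subseteq> image \<tau> ` \<F> \<and> image \<tau> ` \<F> \<subseteq> hits n k (r + 1)"
    using \<delta> by (intro between_hits) (simp add: K_def R_def)
  moreover have "lex_fam n k 1 r = hits n k r" "lex_fam n k 1 (r + 1) = hits n k (r + 1)"
    using nkr k by (intro lex_fam_eq_hits; simp)+
  ultimately show "\<exists>\<sigma>. \<sigma> permutes {1..n} \<and> lex_fam n k 1 r \<subseteq> (image \<sigma>) ` \<F> \<and>
      (image \<sigma>) ` \<F> \<subseteq> lex_fam n k 1 (r + 1)"
    using \<tau> by auto
qed simp

end
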